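(* Let $g\geq 1$, let $n>m\geq 2$, and assume that $(n,m)\neq(4,3)$. Suppose that $\rho_{n,m}\colon B_n(\Sigma_g)\to S_m$ is a homomorphism, and let $\rho_{n,m}(B_n)$ be the image under $\rho_{n,m}$ of the subgroup $B_n=\langle\sigma_1,\ldots,\sigma_{n-1}\rangle$ of $B_n(\Sigma_g)$. (a) The subgroup $\rho_{n,m}(B_n)$ of $S_m$ is cyclic, and therefore $\rho_{n,m}(\sigma_1)=\cdots=\rho_{n,m}(\sigma_{n-1})$. (b) The subgroup $\operatorname{Im}(\rho_{n,m})$ is contained in the centraliser $C_{S_m}(\rho_{n,m}(B_n))$ of $\rho_{n,m}(B_n)$ in $S_m$. This centraliser is isomorphic to $\prod_{k\,:\,\ell_k>0}C_k\wr S_{\ell_k}$, where $\ell_k$ is the number of $k$-cycles ($1\leq k\leq m$, fixed points counting as $1$-cycles) in the cycle decomposition of $\rho_{n,m}(\sigma_1)$. (c) There is an inclusion $\Gamma_3(B_n(\Sigma_g))\subset\operatorname{Ker}(\rho_{n,m})$, so the homomorphism $\rho_{n,m}$ factors through the quotient $B_n(\Sigma_g)/\Gamma_3(B_n(\Sigma_g))$, and the subgroup $\operatorname{Im}(\rho_{n,m})$ is nilpotent of nilpotency degree at most $2$.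
   Context: $\Sigma_g$ is the compact, connected, orientable surface of genus $g$ without boundary, and $B_n(\Sigma_g)$ is its $n$-string braid group, that is, the fundamental group of the quotient by $S_n$ (permuting coordinates) of the configuration space of ordered $n$-tuples of pairwise distinct points of $\Sigma_g$. For $g,n\geq 1$ it admits the following presentation. Generators: $a_1,b_1,\ldots,a_g,b_g,\sigma_1,\ldots,\sigma_{n-1}$. Relations: - $\sigma_i\sigma_j=\sigma_j\sigma_i$ if $|i-j|\geq 2$; - $\sigma_i\sigma_{i+1}\sigma_i=\sigma_{i+1}\sigma_i\sigma_{i+1}$ for $1\leq i\leq n-2$; - $c_i\sigma_j=\sigma_jc_i$ for all $j\geq 2$, $c_i=a_i$ or $b_i$, $i=1,\ldots,g$; - $c_i\sigma_1c_i\sigma_1=\sigma_1c_i\sigma_1c_i$ for $c_i=a_i$ or $b_i$, $i=1,\ldots,g$; - $a_i\sigma_1b_i=\sigma_1b_i\sigma_1a_i\sigma_1$ for $i=1,\ldots,g$; - $c_i\sigma_1^{-1}c_j\sigma_1=\sigma_1^{-1}c_j\sigma_1c_i$ for $c_i=a_i$ or $b_i$, $c_j=a_j$ or $b_j$, $1\leq j<i\leq g$; - $\prod_{i=1}^g[a_i^{-1},b_i]=\sigma_1\cdots\sigma_{n-2}\sigma_{n-1}^2\sigma_{n-2}\cdots\sigma_1$. Here $[x,y]=xyx^{-1}y^{-1}$. The Artin braid group $B_n$ is regarded as the subgroup of $B_n(\Sigma_g)$ generated by $\sigma_1,\ldots,\sigma_{n-1}$ (induced by the inclusion of a topological disc in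 $\Sigma_g$). The lower central series of a group $G$ is given by $\Gamma_1(G)=G$ and $\Gamma_i(G)=[G,\Gamma_{i-1}(G)]$ for $i\geq 2$; nilpotency degree at most $2$ means $\Gamma_3$ is trivial. $C_k$ is the cyclic group of order $k$, and $C_k\wr S_\ell=C_k^\ell\rtimes S_\ell$ is the wreath product with $S_\ell$ permuting the factors. *)

theory Defs
  imports
    "HOL-Analysis.Analysis"
    "HOL-Algebra.Sym_Groups"
    "HOL-Algebra.Product_Groups"
    "HOL-Algebra.Elementary_Groups"
    "HOL-Combinatorics.Orbits"
begin

section \<open>Quotient spaces and the surface of genus \<open>g\<close>\<close>

definition quotient_topology :: "'a topology \<Rightarrow> ('a \<Rightarrow> 'b) \<Rightarrow> 'b topology" where
  "quotient_topology X q =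
     topology (\<lambda>U. U \<subseteq> q ` topspace X \<and> openin X {x \<in> topspace X. q x \<in> U})"

lemma openin_quotient_topology:
  "openin (quotient_topology X q) U \<longleftrightarrow>
     U \<subseteq> q ` topspace X \<and> openin X {x \<in> topspace X. q x \<in> U}"
proof -
  have "istopology (\<lambda>U. U \<subseteq> q ` topspace X \<and> openin X {x \<in> topspace X. q x \<in> U})"
    unfolding istopology_def
  proof (intro conjI allI impI)
    fix S T
    assume "S \<subseteq> q ` topspace X \<and> openin X {x \<in> topspace X. q x \<in> S}"
      and "T \<subseteq> q ` topspace X \<and> openin X {x \<in> topspace X. q x \<in> T}"
    moreover have "{x \<in> topspace X. q x \<in> S \<inter> T} =
        {x \<in> topspace X. q x \<in> S} \<inter> {x \<in> topspace X. q x \<in> T}" by auto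
    ultimately show "S \<inter> T \<subseteq> q ` topspace X" "openin X {x \<in> topspace X. q x \<in> S \<inter> T}"
      by auto
  next
    fix \<K> assume *: "\<forall>K\<in>\<K>. K \<subseteq> q ` topspace X \<and> openin X {x \<in> topspace X. q x \<in> K}"
    have "{x \<in> topspace X. q x \<in> \<Union>\<K>} = (\<Union>K\<in>\<K>. {x \<in> topspace X. q x \<in> K})" by auto
    with * show "\<Union>\<K> \<subseteq> q ` topspace X" "openin X {x \<in> topspace X. q x \<in> \<Union>\<K>}"
      by auto
  qed
  then show ?thesis
    by (simp add: quotient_topology_def topology_inverse')
qed

lemma topspace_quotient_topology: "topspace (quotient_topology X q) = q ` topspace X"
proof -
  have "{x \<in> topspace X. q x \<in> q ` topspace X} = topspace X" by auto
  then have "openin (quotient_topology X q) (q ` topspace X)"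
    by (simp add: openin_quotient_topology)
  then show ?thesis
    by (metis openin_quotient_topology openin_subset openin_topspace subset_antisym)
qed

lemma quotient_map_quotient_topology: "quotient_map X (quotient_topology X q) q"
  by (auto simp: quotient_map_def topspace_quotient_topology openin_quotient_topology)

text \<open>
  The closed unit disc is regarded as a polygon with \<open>4 * g\<close> edges; its vertices are the points
  \<open>polygon_point g k\<close> for \<open>k \<in> {0, \<dots>, 4 * g - 1}\<close>, and \<open>polygon_point g (k + t)\<close> runs
  counterclockwise through its \<open>k\<close>-th edge as \<open>t\<close> runs from 0 to 1.  The edges are glued in pairs
  according to the word \<open>x\<^sub>0 y\<^sub>0 x\<^sub>0\<^sup>-\<^sup>1 y\<^sub>0\<^sup>-\<^sup>1 \<dots> x\<^sub>i y\<^sub>i x\<^sub>i\<^sup>-\<^sup>1 y\<^sub>i\<^sup>-\<^sup>1 \<dots>\<close>, so that edge \<open>4 * i + 2\<close> is edge \<open>4 * i\<close>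
  and edge \<open>4 * i + 3\<close> is edge \<open>4 * i + 1\<close>, both traversed backwards.
\<close>

definition polygon_point :: "nat \<Rightarrow> real \<Rightarrow> complex" where
  "polygon_point g s = cis (2 * pi * s / real (4 * g))"

inductive polygon_glue :: "nat \<Rightarrow> complex \<Rightarrow> complex \<Rightarrow> bool" for g where
  "\<lbrakk>i < g; 0 \<le> t; t \<le> 1\<rbrakk> \<Longrightarrow>
     polygon_glue g (polygon_point g (real (4 * i) + t)) (polygon_point g (real (4 * i + 3) - t))"
| "\<lbrakk>i < g; 0 \<le> t; t \<le> 1\<rbrakk> \<Longrightarrow>
     polygon_glue g (polygon_point g (real (4 * i + 1) + t)) (polygon_point g (real (4 * i + 4) - t))"

text \<open>
  For \<open>g \<ge> 1\<close>: \<open>S\<close> is homeomorphic to the glued polygon, that is, \<open>S\<close> is a compact, connected,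
  orientable surface of genus \<open>g\<close> without boundary.
\<close>

definition genus_surface :: "nat \<Rightarrow> 'a topology \<Rightarrow> bool" where
  "genus_surface g S \<longleftrightarrow>
     (\<exists>q. quotient_map (top_of_set (cball (0 :: complex) 1)) S q \<and>
          (\<forall>z\<in>cball 0 1. \<forall>w\<in>cball 0 1. q z = q w \<longleftrightarrow> equivclp (polygon_glue g) z w))"


section \<open>Fundamental groups\<close>

definition path_join :: "(real \<Rightarrow> 'a) \<Rightarrow> (real \<Rightarrow> 'a) \<Rightarrow> real \<Rightarrow> 'a" where
  "path_join p q = (\<lambda>t. if t \<le> 1/2 then p (2 * t) else q (2 * t - 1))"

definition loops :: "'a topology \<Rightarrow> 'a \<Rightarrow> (real \<Rightarrow> 'a) set" where
  "loops X x = {p. pathin X p \<and> p 0 = x \<and> p 1 = x}"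

definition loop_homotopic :: "'a topology \<Rightarrow> 'a \<Rightarrow> (real \<Rightarrow> 'a) \<Rightarrow> (real \<Rightarrow> 'a) \<Rightarrow> bool" where
  "loop_homotopic X x = homotopic_with (\<lambda>r. r 0 = x \<and> r 1 = x) (top_of_set {0..1}) X"

definition loop_class :: "'a topology \<Rightarrow> 'a \<Rightarrow> (real \<Rightarrow> 'a) \<Rightarrow> (real \<Rightarrow> 'a) set" where
  "loop_class X x p = {q. loop_homotopic X x p q}"

definition fundamental_group :: "'a topology \<Rightarrow> 'a \<Rightarrow> (real \<Rightarrow> 'a) set monoid" where
  "fundamental_group X x =
     \<lparr>carrier = loop_class X x ` loops X x,
      mult = (\<lambda>A B. {r. \<exists>p\<in>A. \<exists>q\<in>B. loop_homotopic X x (path_join p q) r}),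
      one = loop_class X x (\<lambda>_. x)\<rparr>"

lemma loop_homotopic_refl: "p \<in> loops X x \<Longrightarrow> loop_homotopic X x p p"
  by (simp add: loop_homotopic_def loops_def pathin_def)

lemma loop_homotopic_sym: "loop_homotopic X x p q \<Longrightarrow> loop_homotopic X x q p"
  by (simp add: loop_homotopic_def homotopic_with_symD)

lemma loop_homotopic_trans:
  "\<lbrakk>loop_homotopic X x p q; loop_homotopic X x q r\<rbrakk> \<Longrightarrow> loop_homotopic X x p r"
  unfolding loop_homotopic_def by (rule homotopic_with_trans)

lemma loop_homotopic_loops: "loop_homotopic X x p q \<Longrightarrow> p \<in> loops X x \<and> q \<in> loops X x"
  unfolding loop_homotopic_def loops_def pathin_def
  by (auto dest: homotopic_with_imp_continuous_maps homotopic_with_imp_property)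

lemma loop_class_eq:
  assumes "p \<in> loops X x"
  shows "loop_class X x p = loop_class X x q \<longleftrightarrow> loop_homotopic X x p q"
  using assms unfolding loop_class_def
  by (auto intro: loop_homotopic_refl loop_homotopic_sym loop_homotopic_trans)

lemma continuous_map_join_homotopy:
  fixes h k :: "real \<times> real \<Rightarrow> 'a"
  defines "I \<equiv> top_of_set {0..1::real}"
  assumes h: "continuous_map (prod_topology I I) X h" and k: "continuous_map (prod_topology I I) X k"
    and hk: "\<And>s. s \<in> {0..1} \<Longrightarrow> h (s, 1) = k (s, 0)"
  shows "continuous_map (prod_topology I I) X
           (\<lambda>(s, t). if t \<le> 1/2 then h (s, 2 * t) else k (s, 2 * t - 1))"
proof -
  have I2: "prod_topology I I = top_of_set ({0..1} \<times> {0..1})"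
    by (simp add: I_def)
  have top: "topspace (prod_topology I I) = {0..1} \<times> {0..1}"
    by (simp add: I_def)
  have "continuous_map (prod_topology I I) X
           (\<lambda>z. if snd z \<le> 1/2 then h (fst z, 2 * snd z) else k (fst z, 2 * snd z - 1))"
  proof (rule continuous_map_cases_le)
    show "continuous_map (prod_topology I I) euclideanreal snd"
      unfolding I2 by (simp add: continuous_on_snd)
    show "continuous_map (prod_topology I I) euclideanreal (\<lambda>z. 1/2)" by simp
    have "continuous_map (subtopology (prod_topology I I) {z \<in> topspace (prod_topology I I). snd z \<le> 1/2})
            (prod_topology I I) (\<lambda>z. (fst z, 2 * snd z))"
      unfolding top unfolding I2 subtopology_subtopology
      by (auto simp: continuous_map_in_subtopology intro!: continuous_intros)
    then show "continuous_map (subtopology (prod_topology I I) {z \<in> topspace (prod_topology I I). snd z \<le> 1/2})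
            X (\<lambda>z. h (fst z, 2 * snd z))"
      using continuous_map_compose[OF _ h] by (force simp: o_def)
    have "continuous_map (subtopology (prod_topology I I) {z \<in> topspace (prod_topology I I). 1/2 \<le> snd z})
            (prod_topology I I) (\<lambda>z. (fst z, 2 * snd z - 1))"
      unfolding top unfolding I2 subtopology_subtopology
      by (auto simp: continuous_map_in_subtopology intro!: continuous_intros)
    then show "continuous_map (subtopology (prod_topology I I) {z \<in> topspace (prod_topology I I). 1/2 \<le> snd z})
            X (\<lambda>z. k (fst z, 2 * snd z - 1))"
      using continuous_map_compose[OF _ k] by (force simp: o_def)
    show "h (fst z, 2 * snd z) = k (fst z, 2 * snd z - 1)"
      if "z \<in> topspace (prod_topology I I)" "snd z = 1/2" for z
    proof -
      have "fst z \<in> {0..1}"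
        using that(1) by (auto simp: I_def)
      then show ?thesis
        using hk[of "fst z"] by (simp add: that(2))
    qed
  qed
  then show ?thesis
    by (simp add: case_prod_unfold)
qed

lemma loop_homotopic_join:
  assumes "loop_homotopic X x p p'" "loop_homotopic X x q q'"
  shows "loop_homotopic X x (path_join p q) (path_join p' q')"
proof -
  obtain h where h: "continuous_map (prod_topology (top_of_set {0..1::real}) (top_of_set {0..1::real})) X h"
    "\<forall>t. h (0, t) = p t" "\<forall>t. h (1, t) = p' t" "\<forall>s\<in>{0..1}. h (s, 0) = x \<and> h (s, 1) = x"
    using assms(1) unfolding loop_homotopic_def homotopic_with_def by blast
  obtain k where k: "continuous_map (prod_topology (top_of_set {0..1::real}) (top_of_set {0..1::real})) X k"
    "\<forall>t. k (0, t) = q t" "\<forall>t. k (1, t) = q' t" "\<forall>s\<in>{0..1}. k (s, 0) = x \<and> k (s, 1) = x"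
    using assms(2) unfolding loop_homotopic_def homotopic_with_def by blast
  have "continuous_map (prod_topology (top_of_set {0..1::real}) (top_of_set {0..1::real})) X
           (\<lambda>(s, t). if t \<le> 1/2 then h (s, 2 * t) else k (s, 2 * t - 1))"
    by (rule continuous_map_join_homotopy) (use h k in auto)
  then show ?thesis
    unfolding loop_homotopic_def homotopic_with_def path_join_def
    by (rule exI[of _ "\<lambda>(s, t). if t \<le> 1/2 then h (s, 2 * t) else k (s, 2 * t - 1)", OF conjI])
       (use h k in auto)
qed

lemma loop_homotopic_reparametrize:
  fixes f f' :: "real \<Rightarrow> real"
  assumes p: "pathin X p"
    and f: "continuous_on {0..1} f" "f ` {0..1} \<subseteq> {0..1}"
    and f': "continuous_on {0..1} f'" "f' ` {0..1} \<subseteq> {0..1}"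
    and "f 0 = f' 0" "f 1 = f' 1" "p (f 0) = x" "p (f 1) = x"
  shows "loop_homotopic X x (\<lambda>t. p (f t)) (\<lambda>t. p (f' t))"
proof -
  define F where "F = (\<lambda>z::real \<times> real. (1 - fst z) * f (snd z) + fst z * f' (snd z))"
  have "continuous_on ({0..1} \<times> {0..1}) F"
    unfolding F_def
    by (intro continuous_intros continuous_on_compose2[OF f(1)] continuous_on_compose2[OF f'(1)]) auto
  moreover have "F z \<in> {0..1}" if "z \<in> {0..1} \<times> {0..1}" for z
  proof -
    have "f (snd z) \<in> {0..1}" "f' (snd z) \<in> {0..1}" "fst z \<in> {0..1}"
      using that f(2) f'(2) by auto
    then have "f (snd z) + fst z * (f' (snd z) - f (snd z)) \<in> {0..1}"
      using convexD_alt[OF convex_real_interval(5)[of 0 1], of "f (snd z)" "f' (snd z)" "fst z"]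
      by (simp add: algebra_simps)
    then show ?thesis by (simp add: F_def algebra_simps)
  qed
  ultimately have "continuous_map (prod_topology (top_of_set {0..1::real}) (top_of_set {0..1::real}))
      (top_of_set {0..1}) F"
    by (auto simp: continuous_map_in_subtopology)
  then have "continuous_map (prod_topology (top_of_set {0..1::real}) (top_of_set {0..1::real})) X (p \<circ> F)"
    using p continuous_map_compose unfolding pathin_def by blast
  then show ?thesis
    unfolding loop_homotopic_def homotopic_with_def
    by (rule exI[of _ "p \<circ> F", OF conjI]) (use assms in \<open>auto simp: F_def algebra_simps\<close>)
qed

lemma path_join_loops: "\<lbrakk>p \<in> loops X x; q \<in> loops X x\<rbrakk> \<Longrightarrow> path_join p q \<in> loops X x"
  using loop_homotopic_join loop_homotopic_loops loop_homotopic_refl by metis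

lemma loop_class_mult:
  assumes "p \<in> loops X x" "q \<in> loops X x"
  shows "loop_class X x p \<otimes>\<^bsub>fundamental_group X x\<^esub> loop_class X x q = loop_class X x (path_join p q)"
  using assms unfolding fundamental_group_def loop_class_def
  by (auto intro: loop_homotopic_refl loop_homotopic_join loop_homotopic_trans)

lemma const_loops: "x \<in> topspace X \<Longrightarrow> (\<lambda>_. x) \<in> loops X x"
  by (simp add: loops_def pathin_def)

lemma path_join_assoc:
  assumes "p \<in> loops X x" "q \<in> loops X x" "r \<in> loops X x"
  shows "loop_homotopic X x (path_join (path_join p q) r) (path_join p (path_join q r))"
proof -
  let ?P = "path_join (path_join p q) r"
  define f where "f = (\<lambda>t::real. max (t / 2) (max (t - 1/4) (2 * t - 1)))"
  have P: "pathin X ?P" and P01: "?P 0 = x" "?P 1 = x"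
    using path_join_loops[OF path_join_loops[OF assms(1,2)] assms(3)] by (simp_all add: loops_def)
  have "continuous_on {0..1} f"
    unfolding f_def by (intro continuous_intros) auto
  moreover have f01: "f 0 = 0" "f 1 = 1" and "f ` {0..1} \<subseteq> {0..1}"
    by (auto simp: f_def max_def)
  ultimately have "loop_homotopic X x (\<lambda>t. ?P t) (\<lambda>t. ?P (f t))"
    using loop_homotopic_reparametrize[OF P, of "\<lambda>t. t" f x] P01 by (simp add: continuous_on_id)
  moreover have "?P (f t) = path_join p (path_join q r) t" for t
  proof -
    consider "t \<le> 1/2" | "1/2 < t" "t \<le> 3/4" | "3/4 < t" by linarith
    then show ?thesis
    proof cases
      case 1
      then have "f t = t / 2" by (simp add: f_def max_def)
      show ?thesis unfolding \<open>f t = t / 2\<close> using 1 by (simp add: path_join_def)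
    next
      case 2
      then have "f t = t - 1/4" by (simp add: f_def max_def)
      show ?thesis unfolding \<open>f t = t - 1/4\<close> using 2 by (simp add: path_join_def algebra_simps)
    next
      case 3
      then have "f t = 2 * t - 1" by (simp add: f_def max_def)
      show ?thesis unfolding \<open>f t = 2 * t - 1\<close> using 3 by (simp add: path_join_def algebra_simps)
    qed
  qed
  ultimately show ?thesis by simp
qed

lemma path_join_const_left:
  assumes "p \<in> loops X x"
  shows "loop_homotopic X x (path_join (\<lambda>_. x) p) p"
proof -
  define f where "f = (\<lambda>t::real. if t \<le> 1/2 then 0 else 2 * t - 1)"
  have p: "pathin X p" "p 0 = x" "p 1 = x"
    using assms unfolding loops_def by blast+
  have c: "continuous_on {0..1} f"
    unfolding f_def by (intro continuous_on_cases_1 continuous_intros) auto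
  have "loop_homotopic X x (\<lambda>t. p (f t)) (\<lambda>t. p t)"
    by (rule loop_homotopic_reparametrize) (use p c in \<open>auto simp: f_def\<close>)
  moreover have "(\<lambda>t. p (f t)) = path_join (\<lambda>_. x) p"
    using p by (auto simp: f_def path_join_def fun_eq_iff)
  ultimately show ?thesis by simp
qed

lemma path_join_inverse_left:
  assumes "p \<in> loops X x"
  shows "loop_homotopic X x (path_join (\<lambda>t. p (1 - t)) p) (\<lambda>_. x)"
proof -
  define f where "f = (\<lambda>t::real. if t \<le> 1/2 then 1 - 2 * t else 2 * t - 1)"
  have p: "pathin X p" "p 0 = x" "p 1 = x"
    using assms unfolding loops_def by blast+
  have c: "continuous_on {0..1} f"
    unfolding f_def by (intro continuous_on_cases_1 continuous_intros) auto
  have "loop_homotopic X x (\<lambda>t. p (f t)) (\<lambda>t. p 1)"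
    by (rule loop_homotopic_reparametrize) (use p c in \<open>auto simp: f_def\<close>)
  moreover have "(\<lambda>t. p (f t)) = path_join (\<lambda>t. p (1 - t)) p"
    by (auto simp: f_def path_join_def fun_eq_iff)
  ultimately show ?thesis using p by simp
qed

lemma reverse_loops:
  assumes "p \<in> loops X x"
  shows "(\<lambda>t. p (1 - t)) \<in> loops X x"
proof -
  have "continuous_map (top_of_set {0..1}) (top_of_set {0..1}) (\<lambda>t::real. 1 - t)"
    by (auto simp: continuous_map_in_subtopology intro!: continuous_intros)
  then have "continuous_map (top_of_set {0..1}) X (p \<circ> (\<lambda>t. 1 - t))"
    using assms continuous_map_compose unfolding loops_def pathin_def by blast
  then show ?thesis
    using assms by (simp add: loops_def pathin_def o_def)
qed

lemma group_fundamental_group: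
  assumes "x \<in> topspace X"
  shows "group (fundamental_group X x)"
proof -
  let ?G = "fundamental_group X x"
  have carrier: "carrier ?G = loop_class X x ` loops X x"
    and one: "\<one>\<^bsub>?G\<^esub> = loop_class X x (\<lambda>_. x)"
    by (simp_all add: fundamental_group_def)
  show ?thesis
  proof (rule groupI)
    show "\<one>\<^bsub>?G\<^esub> \<in> carrier ?G"
      using const_loops[OF assms] by (simp add: carrier one)
  next
    fix A B assume "A \<in> carrier ?G" "B \<in> carrier ?G"
    then show "A \<otimes>\<^bsub>?G\<^esub> B \<in> carrier ?G"
      by (auto simp: carrier loop_class_mult path_join_loops)
  next
    fix A B C assume "A \<in> carrier ?G" "B \<in> carrier ?G" "C \<in> carrier ?G"
    then obtain p q r where *: "p \<in> loops X x" "q \<in> loops X x" "r \<in> loops X x"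
      and [simp]: "A = loop_class X x p" "B = loop_class X x q" "C = loop_class X x r"
      by (auto simp: carrier)
    show "A \<otimes>\<^bsub>?G\<^esub> B \<otimes>\<^bsub>?G\<^esub> C = A \<otimes>\<^bsub>?G\<^esub> (B \<otimes>\<^bsub>?G\<^esub> C)"
      using * by (simp add: loop_class_mult path_join_loops loop_class_eq path_join_assoc)
  next
    fix A assume "A \<in> carrier ?G"
    then obtain p where p: "p \<in> loops X x" and [simp]: "A = loop_class X x p"
      by (auto simp: carrier)
    show "\<one>\<^bsub>?G\<^esub> \<otimes>\<^bsub>?G\<^esub> A = A"
      using p const_loops[OF assms]
      by (simp add: one loop_class_mult path_join_loops loop_class_eq path_join_const_left)
    have "loop_class X x (\<lambda>t. p (1 - t)) \<otimes>\<^bsub>?G\<^esub> A = \<one>\<^bsub>?G\<^esub>"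
      using p reverse_loops[OF p]
      by (simp add: one loop_class_mult path_join_loops loop_class_eq path_join_inverse_left)
    then show "\<exists>B\<in>carrier ?G. B \<otimes>\<^bsub>?G\<^esub> A = \<one>\<^bsub>?G\<^esub>"
      using reverse_loops[OF p] by (auto simp: carrier)
  qed
qed


section \<open>Surface braid groups\<close>

definition configuration_space :: "nat \<Rightarrow> 'a topology \<Rightarrow> (nat \<Rightarrow> 'a) topology" where
  "configuration_space n S =
     subtopology (product_topology (\<lambda>_. S) {1..n}) {x. inj_on x {1..n}}"

text \<open>Its points are the orbits of the action of the symmetric group by permutation of coordinates.\<close>

definition unordered_configuration_space :: "nat \<Rightarrow> 'a topology \<Rightarrow> (nat \<Rightarrow> 'a) set topology" where
  "unordered_configuration_space n S =
     quotient_topology (configuration_space n S) (\<lambda>x. {x \<circ> p |p. p permutes {1..n}})"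

definition surface_braid_group ::
  "nat \<Rightarrow> 'a topology \<Rightarrow> (nat \<Rightarrow> 'a) set \<Rightarrow> (real \<Rightarrow> (nat \<Rightarrow> 'a) set) set monoid" where
  "surface_braid_group n S Q = fundamental_group (unordered_configuration_space n S) Q"

lemma group_surface_braid_group:
  "Q \<in> topspace (unordered_configuration_space n S) \<Longrightarrow> group (surface_braid_group n S Q)"
  by (simp add: surface_braid_group_def group_fundamental_group)


section \<open>Group presentations\<close>

text \<open>The letters \<open>pos x\<close> and \<open>neg x\<close> stand for the generator \<open>x\<close> and its formal inverse.\<close>

type_synonym 'x word = "('x \<times> bool) list"

definition pos :: "'x \<Rightarrow> 'x \<times> bool" where "pos x = (x, True)"
definition neg :: "'x \<Rightarrow> 'x \<times> bool" where "neg x = (x, False)"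

definition words :: "'x set \<Rightarrow> 'x word set" where
  "words X = lists (X \<times> UNIV)"

text \<open>
  A pair \<open>(u, v) \<in> R\<close> is the relation \<open>u = v\<close>.  Two words are related by \<open>presentation_eq X R\<close> iff they
  represent the same element of the group with generators \<open>X\<close> and relations \<open>R\<close>.
\<close>

inductive presentation_eq :: "'x set \<Rightarrow> ('x word \<times> 'x word) set \<Rightarrow> 'x word \<Rightarrow> 'x word \<Rightarrow> bool"
  for X R where
  refl: "presentation_eq X R u u"
| sym: "presentation_eq X R u v \<Longrightarrow> presentation_eq X R v u"
| trans: "\<lbrakk>presentation_eq X R u v; presentation_eq X R v w\<rbrakk> \<Longrightarrow> presentation_eq X R u w"
| relation: "\<lbrakk>(u, v) \<in> R; p \<in> words X; q \<in> words X\<rbrakk> \<Longrightarrow> presentation_eq X R (p @ u @ q) (p @ v @ q)"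
| cancel_right: "\<lbrakk>x \<in> X; p \<in> words X; q \<in> words X\<rbrakk> \<Longrightarrow> presentation_eq X R (p @ [pos x, neg x] @ q) (p @ q)"
| cancel_left: "\<lbrakk>x \<in> X; p \<in> words X; q \<in> words X\<rbrakk> \<Longrightarrow> presentation_eq X R (p @ [neg x, pos x] @ q) (p @ q)"

fun word_value :: "('g, 'm) monoid_scheme \<Rightarrow> ('x \<Rightarrow> 'g) \<Rightarrow> 'x word \<Rightarrow> 'g" where
  "word_value G f [] = \<one>\<^bsub>G\<^esub>"
| "word_value G f ((x, e) # w) = (if e then f x else inv\<^bsub>G\<^esub> f x) \<otimes>\<^bsub>G\<^esub> word_value G f w"

text \<open>The group \<open>G\<close> has the presentation \<open>\<langle>X | R\<rangle>\<close>, the generator \<open>x \<in> X\<close> being the element \<open>f x\<close> of \<open>G\<close>.\<close>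

definition has_presentation ::
  "('g, 'm) monoid_scheme \<Rightarrow> 'x set \<Rightarrow> ('x word \<times> 'x word) set \<Rightarrow> ('x \<Rightarrow> 'g) \<Rightarrow> bool" where
  "has_presentation G X R f \<longleftrightarrow>
     f ` X \<subseteq> carrier G \<and>
     carrier G = word_value G f ` words X \<and>
     (\<forall>u\<in>words X. \<forall>v\<in>words X. word_value G f u = word_value G f v \<longleftrightarrow> presentation_eq X R u v)"

datatype braid_generator = Gen_a nat | Gen_b nat | Gen_s nat

definition surface_braid_generators :: "nat \<Rightarrow> nat \<Rightarrow> braid_generator set" where
  "surface_braid_generators g n = Gen_a ` {1..g} \<union> Gen_b ` {1..g} \<union> Gen_s ` {1..<n}"

text \<open>For \<open>n \<ge> 2\<close> (the relations of \<open>Gen_s 1\<close> with \<open>Gen_a i\<close> and \<open>Gen_b i\<close> make no sense for \<open>n = 1\<close>).\<close>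

inductive_set surface_braid_relations ::
  "nat \<Rightarrow> nat \<Rightarrow> (braid_generator word \<times> braid_generator word) set" for g n where
  s_s_far: "\<lbrakk>i \<in> {1..<n}; j \<in> {1..<n}; i + 2 \<le> j \<or> j + 2 \<le> i\<rbrakk> \<Longrightarrow>
     ([pos (Gen_s i), pos (Gen_s j)], [pos (Gen_s j), pos (Gen_s i)]) \<in> surface_braid_relations g n"
| s_s_near: "\<lbrakk>1 \<le> i; i + 2 \<le> n\<rbrakk> \<Longrightarrow>
     ([pos (Gen_s i), pos (Gen_s (i + 1)), pos (Gen_s i)],
      [pos (Gen_s (i + 1)), pos (Gen_s i), pos (Gen_s (i + 1))]) \<in> surface_braid_relations g n"
| c_s_far: "\<lbrakk>i \<in> {1..g}; c \<in> {Gen_a i, Gen_b i}; j \<in> {2..<n}\<rbrakk> \<Longrightarrow>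
     ([pos c, pos (Gen_s j)], [pos (Gen_s j), pos c]) \<in> surface_braid_relations g n"
| c_s_near: "\<lbrakk>i \<in> {1..g}; c \<in> {Gen_a i, Gen_b i}\<rbrakk> \<Longrightarrow>
     ([pos c, pos (Gen_s 1), pos c, pos (Gen_s 1)],
      [pos (Gen_s 1), pos c, pos (Gen_s 1), pos c]) \<in> surface_braid_relations g n"
| a_b: "i \<in> {1..g} \<Longrightarrow>
     ([pos (Gen_a i), pos (Gen_s 1), pos (Gen_b i)],
      [pos (Gen_s 1), pos (Gen_b i), pos (Gen_s 1), pos (Gen_a i), pos (Gen_s 1)])
       \<in> surface_braid_relations g n"
| c_d: "\<lbrakk>1 \<le> j; j < i; i \<le> g; c \<in> {Gen_a i, Gen_b i}; d \<in> {Gen_a j, Gen_b j}\<rbrakk> \<Longrightarrow>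
     ([pos c, neg (Gen_s 1), pos d, pos (Gen_s 1)],
      [neg (Gen_s 1), pos d, pos (Gen_s 1), pos c]) \<in> surface_braid_relations g n"
| surface:
     "(concat (map (\<lambda>i. [neg (Gen_a i), pos (Gen_b i), pos (Gen_a i), neg (Gen_b i)]) [1..<g + 1]),
       map (\<lambda>i. pos (Gen_s i)) [1..<n] @ rev (map (\<lambda>i. pos (Gen_s i)) [1..<n]))
       \<in> surface_braid_relations g n"


section \<open>Group theory\<close>

definition centraliser :: "('g, 'm) monoid_scheme \<Rightarrow> 'g set \<Rightarrow> 'g set" where
  "centraliser G H = {x \<in> carrier G. \<forall>h\<in>H. x \<otimes>\<^bsub>G\<^esub> h = h \<otimes>\<^bsub>G\<^esub> x}"

text \<open>The series starts at index 1; the value at 0 is a dummy.\<close>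

fun lower_central_series :: "('g, 'm) monoid_scheme \<Rightarrow> nat \<Rightarrow> 'g set" where
  "lower_central_series G 0 = carrier G"
| "lower_central_series G (Suc 0) = carrier G"
| "lower_central_series G (Suc (Suc i)) =
     generate G {x \<otimes>\<^bsub>G\<^esub> y \<otimes>\<^bsub>G\<^esub> inv\<^bsub>G\<^esub> x \<otimes>\<^bsub>G\<^esub> inv\<^bsub>G\<^esub> y |x y.
                   x \<in> carrier G \<and> y \<in> lower_central_series G (Suc i)}"

text \<open>\<open>G \<wr> S\<^sub>l\<close>, where \<open>p\<close> moves the factor with index \<open>i\<close> to the factor with index \<open>p i\<close>.\<close>

definition wreath_product :: "('g, 'm) monoid_scheme \<Rightarrow> nat \<Rightarrow> ((nat \<Rightarrow> 'g) \<times> (nat \<Rightarrow> nat)) monoid" where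
  "wreath_product G l =
     \<lparr>carrier = (\<Pi>\<^sub>E i\<in>{1..l}. carrier G) \<times> {p. p permutes {1..l}},
      mult = (\<lambda>(x, p) (y, q). (\<lambda>i\<in>{1..l}. x i \<otimes>\<^bsub>G\<^esub> y (inv_into UNIV p i), p \<circ> q)),
      one = (\<lambda>i\<in>{1..l}. \<one>\<^bsub>G\<^esub>, id)\<rparr>"

text \<open>
  The number of \<open>k\<close>-cycles of a permutation \<open>p\<close> of \<open>{1..m}\<close>, a cycle being given by its underlying
  set; fixed points are counted for \<open>k = 1\<close>.
\<close>

definition cycle_count :: "nat \<Rightarrow> (nat \<Rightarrow> nat) \<Rightarrow> nat \<Rightarrow> nat" where
  "cycle_count m p k = card {C. \<exists>x\<in>{1..m}. C = orbit p x \<and> card C = k}"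

end

theory Submission
  imports Defs
begin

text \<open>
  Only the relations of the presentation matter.  For \<open>m < n\<close> an action of \<open>B\<^sub>n\<close> on \<open>m\<close> points
  factors through \<open>\<int>\<close> unless \<open>(n, m) = (4, 3)\<close>: let \<open>t\<close> be the permutation given by \<open>\<sigma>\<^bsub>n-1\<^esub>\<close>.
  The generators \<open>\<sigma>\<^sub>1, \<dots>, \<sigma>\<^bsub>n-3\<^esub>\<close> commute with \<open>t\<close>, so they act on the fixed points of \<open>t\<close> and on the
  set of its nontrivial cycles.  If \<open>n \<ge> 7\<close>, both sets have fewer than \<open>n - 2\<close> elements, and by
  induction the generators act on them in the same way, that is, they agree up to powers of \<open>t\<close>
  on each cycle.  These powers commute, which forces \<open>\<sigma>\<^sub>1\<close> and \<open>\<sigma>\<^sub>2\<close> to commute and hence to be equal.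
  For \<open>n = 5, 6\<close> the cycle type of \<open>t\<close> is so restricted that a direct argument works.

  Hence all \<open>\<sigma>\<^sub>i\<close> have the same image \<open>s\<close>.  It is central in the image of \<open>\<rho>\<close>, because \<open>a\<^sub>i\<close> and \<open>b\<^sub>i\<close>
  commute with \<open>\<sigma>\<^sub>2\<close>.  The remaining relations then say that the images of the generators commute up
  to powers of \<open>s\<^sup>2\<close>, so the image has nilpotency degree at most 2.
\<close>


section \<open>Braid group actions on few points\<close>

text \<open>Only the values on \<open>X\<close> count, and \<open>s i\<close> is unconstrained for
  \<open>i = 0\<close> and \<open>i \<ge> n\<close>. So one family \<open>s\<close> serves for all
  invariant subsets, and passing to fewer strands only lowers \<open>n\<close>.\<close>

definition braid_action :: "nat \<Rightarrow> (nat \<Rightarrow> 'a \<Rightarrow> 'a) \<Rightarrow> 'a set \<Rightarrow> bool" where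
  "braid_action n s X \<longleftrightarrow>
     (\<forall>i. 1 \<le> i \<and> i < n \<longrightarrow> bij_betw (s i) X X) \<and>
     (\<forall>i j x. 1 \<le> i \<and> i + 2 \<le> j \<and> j < n \<and> x \<in> X \<longrightarrow> s i (s j x) = s j (s i x)) \<and>
     (\<forall>i x. 1 \<le> i \<and> i + 2 \<le> n \<and> x \<in> X \<longrightarrow>
        s i (s (Suc i) (s i x)) = s (Suc i) (s i (s (Suc i) x)))"

lemma braid_actionI:
  assumes "\<And>i. 1 \<le> i \<Longrightarrow> i < n \<Longrightarrow> bij_betw (s i) X X"
    and "\<And>i j x. 1 \<le> i \<Longrightarrow> i + 2 \<le> j \<Longrightarrow> j < n \<Longrightarrow> x \<in> X \<Longrightarrow> s i (s j x) = s j (s i x)"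
    and "\<And>i x. 1 \<le> i \<Longrightarrow> i + 2 \<le> n \<Longrightarrow> x \<in> X \<Longrightarrow>
      s i (s (Suc i) (s i x)) = s (Suc i) (s i (s (Suc i) x))"
  shows "braid_action n s X"
  unfolding braid_action_def using assms by blast

lemma braid_action_bij: "braid_action n s X \<Longrightarrow> 1 \<le> i \<Longrightarrow> i < n \<Longrightarrow> bij_betw (s i) X X"
  unfolding braid_action_def by blast

lemma braid_action_in:
  "braid_action n s X \<Longrightarrow> 1 \<le> i \<Longrightarrow> i < n \<Longrightarrow> x \<in> X \<Longrightarrow> s i x \<in> X"
  using braid_action_bij bij_betwE by blast

lemma braid_action_far:
  assumes "braid_action n s X" "1 \<le> i" "i < n" "1 \<le> j" "j < n" "i + 2 \<le> j \<or> j + 2 \<le> i" "x \<in> X"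
  shows "s i (s j x) = s j (s i x)"
proof -
  have far: "\<And>i j. \<lbrakk>1 \<le> i; i + 2 \<le> j; j < n\<rbrakk> \<Longrightarrow> s i (s j x) = s j (s i x)"
    using assms(1,7) unfolding braid_action_def by blast
  show ?thesis
    using assms(6)
  proof
    assume "i + 2 \<le> j"
    then show ?thesis by (intro far assms)
  next
    assume "j + 2 \<le> i"
    then show ?thesis by (intro far[symmetric] assms)
  qed
qed

lemma braid_action_near:
  "braid_action n s X \<Longrightarrow> 1 \<le> i \<Longrightarrow> i + 2 \<le> n \<Longrightarrow> x \<in> X \<Longrightarrow>
    s i (s (Suc i) (s i x)) = s (Suc i) (s i (s (Suc i) x))"
  unfolding braid_action_def by blast

lemma braid_action_mono:
  assumes act: "braid_action n s X" and "k \<le> n"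
  shows "braid_action k s X"
proof (rule braid_actionI)
  show "bij_betw (s i) X X" if "1 \<le> i" "i < k" for i
    by (rule braid_action_bij[OF act]) (use assms that in auto)
  show "s i (s j x) = s j (s i x)" if "1 \<le> i" "i + 2 \<le> j" "j < k" "x \<in> X" for i j x
    by (rule braid_action_far[OF act]) (use assms that in auto)
  show "s i (s (Suc i) (s i x)) = s (Suc i) (s i (s (Suc i) x))" if "1 \<le> i" "i + 2 \<le> k" "x \<in> X" for i x
    by (rule braid_action_near[OF act]) (use assms that in auto)
qed

text \<open>Actions descend along equivariant surjections; finiteness turns surjectivity of the
  induced maps into bijectivity. This gives the action on the cycles of a permutation and the
  renumbering of points by naturals.\<close>

lemma braid_action_semiconj:
  assumes act: "braid_action n s X" and fin: "finite X" and Y: "f ` X = Y"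
    and s': "\<And>i x. 1 \<le> i \<Longrightarrow> i < n \<Longrightarrow> x \<in> X \<Longrightarrow> s' i (f x) = f (s i x)"
  shows "braid_action n s' Y"
proof (rule braid_actionI)
  note closed = braid_action_in[OF act]
  show "bij_betw (s' i) Y Y" if i: "1 \<le> i" "i < n" for i
  proof -
    have "s' i ` Y = f ` s i ` X"
      using s' i unfolding Y[symmetric] by (force simp: image_image)
    also have "\<dots> = Y"
      using braid_action_bij[OF act, of i] i Y by (simp add: bij_betw_def)
    finally have "s' i ` Y = Y" .
    moreover have "finite Y"
      using fin Y by blast
    ultimately show ?thesis
      by (simp add: bij_betw_def finite_surj_inj)
  qed
  show "s' i (s' j y) = s' j (s' i y)"
    if ij: "1 \<le> i" "i + 2 \<le> j" "j < n" and "y \<in> Y" for i j y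
  proof -
    obtain x where "x \<in> X" "y = f x" using \<open>y \<in> Y\<close> Y by blast
    then show ?thesis
      using braid_action_far[OF act, of i j x] ij by (simp add: s' closed)
  qed
  show "s' i (s' (Suc i) (s' i y)) = s' (Suc i) (s' i (s' (Suc i) y))"
    if i: "1 \<le> i" "i + 2 \<le> n" and "y \<in> Y" for i y
  proof -
    obtain x where "x \<in> X" "y = f x" using \<open>y \<in> Y\<close> Y by blast
    then show ?thesis
      using braid_action_near[OF act, of i x] i by (simp add: s' closed)
  qed
qed

lemma bij_betw_closed_subset:
  assumes "finite X" "bij_betw p X X" "Y \<subseteq> X" "\<And>y. y \<in> Y \<Longrightarrow> p y \<in> Y"
  shows "bij_betw p Y Y"
proof -
  have "inj_on p Y"
    using assms by (auto simp: bij_betw_def intro: inj_on_subset)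
  moreover have "p ` Y \<subseteq> Y"
    using assms by auto
  ultimately show ?thesis
    using finite_subset[OF assms(3,1)] by (simp add: bij_betw_def endo_inj_surj)
qed

lemma braid_action_subset:
  assumes act: "braid_action n s X" and fin: "finite X" and "Y \<subseteq> X"
    and closed: "\<And>i y. 1 \<le> i \<Longrightarrow> i < n \<Longrightarrow> y \<in> Y \<Longrightarrow> s i y \<in> Y"
  shows "braid_action n s Y"
proof (rule braid_actionI)
  show "bij_betw (s i) Y Y" if "1 \<le> i" "i < n" for i
    by (rule bij_betw_closed_subset[OF fin braid_action_bij[OF act that] \<open>Y \<subseteq> X\<close> closed[OF that]])
  show "s i (s j x) = s j (s i x)" if "1 \<le> i" "i + 2 \<le> j" "j < n" "x \<in> Y" for i j x
    by (rule braid_action_far[OF act]) (use \<open>Y \<subseteq> X\<close> that in auto)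
  show "s i (s (Suc i) (s i x)) = s (Suc i) (s i (s (Suc i) x))" if "1 \<le> i" "i + 2 \<le> n" "x \<in> Y" for i x
    by (rule braid_action_near[OF act]) (use \<open>Y \<subseteq> X\<close> that in auto)
qed

section \<open>Generators that are forced to coincide\<close>

text \<open>Every \<open>x\<close> has the form \<open>q (p z) = p (q z)\<close>, and for such
  \<open>x\<close> the braid relation at \<open>z\<close> reads \<open>p x = q x\<close>.\<close>

lemma commuting_braid_eq:
  assumes p: "bij_betw p X X" and q: "bij_betw q X X"
    and comm: "\<And>x. x \<in> X \<Longrightarrow> p (q x) = q (p x)"
    and braid: "\<And>x. x \<in> X \<Longrightarrow> p (q (p x)) = q (p (q x))"
    and x: "x \<in> X"
  shows "p x = q x"
proof -
  have cl: "p y \<in> X" "q y \<in> X" if "y \<in> X" for y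
    using p q that bij_betwE by metis+
  obtain y where y: "y \<in> X" "x = q y"
    using q x unfolding bij_betw_def by blast
  obtain z where z: "z \<in> X" "y = p z"
    using p y unfolding bij_betw_def by blast
  have "p (p (q z)) = q (p (q z))"
    using braid[OF z(1)] comm cl z(1) by simp
  then show ?thesis
    using y z comm by simp
qed

text \<open>Equality spreads along the chain: if \<open>s i\<close> and \<open>s (Suc i)\<close>
  agree, then \<open>s (Suc (Suc i))\<close>, which commutes with the first, commutes with the
  second and hence equals it. The mirror argument goes downwards.\<close>

lemma braid_action_all_eq:
  assumes act: "braid_action n s X" and k: "1 \<le> k" "k + 2 \<le> n"
    and eq: "\<And>x. x \<in> X \<Longrightarrow> s k x = s (Suc k) x"
    and j: "1 \<le> j" "j < n" and x: "x \<in> X"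
  shows "s j x = s 1 x"
proof -
  note bij = braid_action_bij[OF act] and far = braid_action_far[OF act]
    and near = braid_action_near[OF act] and closed = braid_action_in[OF act]
  have up: "\<forall>x\<in>X. s i x = s (Suc i) x" if "k \<le> i" "i + 2 \<le> n" for i
    using that
  proof (induction rule: dec_induct)
    case base
    then show ?case using eq by blast
  next
    case (step i)
    have e: "s i y = s (Suc i) y" if "y \<in> X" for y
      using step that by auto
    have "s (Suc i) (s (Suc (Suc i)) x) = s (Suc (Suc i)) (s (Suc i) x)" if "x \<in> X" for x
    proof -
      have "s i (s (Suc (Suc i)) x) = s (Suc (Suc i)) (s i x)"
        by (rule far) (use that k step.hyps step.prems in auto)
      moreover have "s (Suc (Suc i)) x \<in> X"
        by (rule closed) (use that k step.hyps step.prems in auto)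
      ultimately show ?thesis
        using e that by metis
    qed
    moreover have "s (Suc i) (s (Suc (Suc i)) (s (Suc i) x)) =
        s (Suc (Suc i)) (s (Suc i) (s (Suc (Suc i)) x))" if "x \<in> X" for x
      by (rule near) (use that k step.hyps step.prems in auto)
    moreover have "bij_betw (s (Suc i)) X X" "bij_betw (s (Suc (Suc i))) X X"
      by (rule bij; use k step.hyps step.prems in simp)+
    ultimately show ?case
      using commuting_braid_eq[of "s (Suc i)" X "s (Suc (Suc i))"] by blast
  qed
  have down: "\<forall>x\<in>X. s i x = s (Suc i) x" if "i \<le> k" "1 \<le> i" for i
    using that
  proof (induction rule: inc_induct)
    case base
    then show ?case using eq by blast
  next
    case (step i)
    have e: "s (Suc i) y = s (Suc (Suc i)) y" if "y \<in> X" for y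
      using step that by auto
    have "s i (s (Suc i) x) = s (Suc i) (s i x)" if "x \<in> X" for x
    proof -
      have "s i (s (Suc (Suc i)) x) = s (Suc (Suc i)) (s i x)"
        by (rule far) (use that k step.hyps step.prems in auto)
      moreover have "s i x \<in> X"
        by (rule closed) (use that k step.hyps step.prems in auto)
      ultimately show ?thesis
        using e that by metis
    qed
    moreover have "s i (s (Suc i) (s i x)) = s (Suc i) (s i (s (Suc i) x))" if "x \<in> X" for x
      by (rule near) (use that k step.hyps step.prems in auto)
    moreover have "bij_betw (s i) X X" "bij_betw (s (Suc i)) X X"
      by (rule bij; use k step.hyps step.prems in simp)+
    ultimately show ?case
      using commuting_braid_eq[of "s i" X "s (Suc i)"] by blast
  qed
  have all: "\<forall>x\<in>X. s i x = s (Suc i) x" if "1 \<le> i" "i + 2 \<le> n" for i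
    using up[of i] down[of i] that by (meson nat_le_linear)
  from j have "\<forall>x\<in>X. s j x = s 1 x"
  proof (induction rule: dec_induct)
    case (step i)
    have "\<forall>x\<in>X. s i x = s (Suc i) x"
      by (rule all) (use step.hyps step.prems in linarith)+
    moreover have "\<forall>x\<in>X. s i x = s 1 x"
      by (rule step.IH) (use step.prems in linarith)
    ultimately show ?case by (auto simp del: One_nat_def)
  qed blast
  then show ?thesis using x by blast
qed

text \<open>The symmetric group on at most two points is abelian of exponent at most 2.\<close>

lemma bij_betw_card_le_2:
  assumes "finite Y" "card Y \<le> 2" "bij_betw p Y Y" "bij_betw q Y Y" "y \<in> Y"
  shows "p (q y) = q (p y)" and "p (p y) = y"
proof -
  consider "Y = {y}" | z where "z \<noteq> y" "Y = {y, z}"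
  proof (cases "Y = {y}")
    case False
    then obtain z where z: "z \<in> Y" "z \<noteq> y" using assms(5) by blast
    then have "{y, z} \<subseteq> Y" "card Y \<le> card {y, z}" using assms by auto
    then have "Y = {y, z}" using assms(1) card_seteq by blast
    then show ?thesis using that z by blast
  qed (use that in blast)
  then have "p (q y) = q (p y) \<and> p (p y) = y"
  proof cases
    case 1
    then show ?thesis using assms by (auto simp: bij_betw_def)
  next
    case 2
    have "p y \<in> {y, z}" "p z \<in> {y, z}" "q y \<in> {y, z}" "q z \<in> {y, z}" "p y \<noteq> p z" "q y \<noteq> q z"
      using 2 assms(3,4) bij_betwE[of p] bij_betwE[of q] by (auto simp: bij_betw_def inj_on_def)
    then show ?thesis by (metis insert_iff empty_iff)
  qed
  then show "p (q y) = q (p y)" and "p (p y) = y" by blast+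
qed

section \<open>Cycles of a permutation and maps commuting with it\<close>

lemma commute_funpow:
  assumes "\<And>x. x \<in> X \<Longrightarrow> p (t x) = t (p x)" "\<And>x. x \<in> X \<Longrightarrow> t x \<in> X" "x \<in> X"
  shows "p ((t ^^ k) x) = (t ^^ k) (p x)"
proof -
  have "(t ^^ k) x \<in> X \<and> p ((t ^^ k) x) = (t ^^ k) (p x)"
    using assms by (induction k) auto
  then show ?thesis by blast
qed

lemma orbit_eq_iff:
  assumes "permutation t"
  shows "orbit t x = orbit t y \<longleftrightarrow> (\<exists>k. x = (t ^^ k) y)"
proof
  assume "orbit t x = orbit t y"
  then have "x \<in> orbit t y"
    using permutation_self_in_orbit[OF assms] by metis
  then show "\<exists>k. x = (t ^^ k) y"
    using orbit_altdef_permutation[OF assms] by blast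
next
  assume "\<exists>k. x = (t ^^ k) y"
  then have "x \<in> orbit t y"
    using orbit_altdef_permutation[OF assms] by blast
  then show "orbit t x = orbit t y"
    using orbit_cyclic_eq3[OF cyclic_on_orbit'[OF assms]] by blast
qed

lemma image_orbit_commute:
  assumes "t permutes X" "finite X" "\<And>x. x \<in> X \<Longrightarrow> p (t x) = t (p x)" "x \<in> X"
  shows "p ` orbit t x = orbit t (p x)"
proof (rule orbit_inverse)
  show "x \<in> orbit t x"
    using assms permutation_self_in_orbit permutation_permutes by metis
  show "t (p y) = p (t y)" if "y \<in> orbit t x" for y
    using assms that permutes_orbit_subset[OF assms(1,4)] by (metis subsetD)
qed

text \<open>The nontrivial cycles partition \<open>M\<close>, and each contains the two distinct
  points \<open>x\<close> and \<open>t x\<close>.\<close>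

lemma card_orbits_moved:
  fixes t :: "'a \<Rightarrow> 'a"
  assumes t: "t permutes X" and fin: "finite X"
  defines "M \<equiv> {x \<in> X. t x \<noteq> x}"
  shows "2 * card (orbit t ` M) \<le> card M"
proof -
  have perm: "permutation t" using t fin permutation_permutes by metis
  have self: "x \<in> orbit t x" for x using permutation_self_in_orbit[OF perm] .
  have eq: "orbit t y = orbit t x" if "y \<in> orbit t x" for x y
    using orbit_cyclic_eq3[OF cyclic_on_orbit'[OF perm] that] .
  have sub: "orbit t x \<subseteq> M" if "x \<in> M" for x
  proof
    fix y assume y: "y \<in> orbit t x"
    then have "y \<in> X" using permutes_orbit_subset[OF t] that by (auto simp: M_def)
    moreover have "t y \<noteq> y"
    proof
      assume "t y = y"
      then have "orbit t y = {y}" by (simp add: orbit_eq_singleton_iff)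
      then have "orbit t x = {y}" using eq[OF y] by simp
      then have "x = y" using self[of x] by simp
      then show False using \<open>t y = y\<close> that by (simp add: M_def)
    qed
    ultimately show "y \<in> M" by (simp add: M_def)
  qed
  have "card (\<Union> (orbit t ` M)) = sum card (orbit t ` M)"
  proof (rule card_Union_disjoint)
    show "pairwise disjnt (orbit t ` M)"
      unfolding pairwise_def disjnt_def using eq by blast
    show "finite A" if "A \<in> orbit t ` M" for A
      using that finite_orbit[OF self] by auto
  qed
  moreover have "\<Union> (orbit t ` M) = M" using sub self by blast
  moreover have "2 \<le> card C" if "C \<in> orbit t ` M" for C
  proof -
    obtain x where x: "x \<in> M" "C = orbit t x" using \<open>C \<in> _\<close> by blast
    then have "{x, t x} \<subseteq> C" using self orbit.base by fast
    moreover have "finite C" using x finite_orbit[OF self] by simp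
    moreover have "card {x, t x} = 2" using x card_2_iff[of "{x, t x}"] by (auto simp: M_def)
    ultimately show ?thesis using card_mono by metis
  qed
  ultimately show ?thesis
    using sum_bounded_below[of "orbit t ` M" 2 card] by (simp add: mult.commute)
qed

text \<open>Here \<open>t\<close>, \<open>p\<close>, \<open>q\<close>, \<open>u\<close> play the roles of \<open>\<sigma>\<^bsub>n-1\<^esub>\<close>, \<open>\<sigma>\<^sub>1\<close>, \<open>\<sigma>\<^sub>2\<close>, \<open>\<sigma>\<^sub>4\<close>.  Since \<open>u\<close>
  commutes with \<open>q\<close>, replacing \<open>u\<close> by \<open>p\<close> up to a power of \<open>t\<close> makes \<open>p\<close> commute with \<open>q\<close>.\<close>

lemma commute_of_eq_modulo_powers:
  assumes t: "bij_betw t X X" and p: "bij_betw p X X" and q: "bij_betw q X X" and u: "bij_betw u X X"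
    and pt: "\<And>x. x \<in> X \<Longrightarrow> p (t x) = t (p x)" and qt: "\<And>x. x \<in> X \<Longrightarrow> q (t x) = t (q x)"
    and ut: "\<And>x. x \<in> X \<Longrightarrow> u (t x) = t (u x)"
    and up: "\<And>x. x \<in> X \<Longrightarrow> u (p x) = p (u x)" and uq: "\<And>x. x \<in> X \<Longrightarrow> u (q x) = q (u x)"
    and qp: "\<And>x. x \<in> X \<Longrightarrow> \<exists>a. q x = (t ^^ a) (p x)"
    and u_p: "\<And>x. x \<in> X \<Longrightarrow> \<exists>b. u x = (t ^^ b) (p x)"
    and x: "x \<in> X"
  shows "p (q x) = q (p x)"
proof -
  have cl: "t y \<in> X" "p y \<in> X" "q y \<in> X" "u y \<in> X" if "y \<in> X" for y
    using t p q u that bij_betwE by metis+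
  note P = commute_funpow[of X p t, OF pt cl(1)] and Q = commute_funpow[of X q t, OF qt cl(1)]
    and U = commute_funpow[of X u t, OF ut cl(1)]
  obtain a where a: "q x = (t ^^ a) (p x)" using qp x by blast
  obtain b where b: "u x = (t ^^ b) (p x)" using u_p x by blast
  have tb: "inj_on (t ^^ b) X" "\<And>y. y \<in> X \<Longrightarrow> (t ^^ b) y \<in> X" for b
    using bij_betw_funpow[OF t, of b] unfolding bij_betw_def by blast+
  have "(t ^^ b) (q (p x)) = q (u x)"
    using b Q[of "p x" b] cl x by simp
  also have "\<dots> = u (q x)"
    using uq x by simp
  \<comment> \<open>The exponents depend on the point. Moving \<open>u\<close> past \<open>p\<close>
    ensures that only those at \<open>x\<close> itself are used.\<close>
  also have "\<dots> = (t ^^ a) (p (u x))"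
    using a U[of "p x" a] up cl x by simp
  also have "\<dots> = (t ^^ a) ((t ^^ b) (p (p x)))"
    using b P[of "p x" b] cl x by simp
  also have "\<dots> = (t ^^ b) ((t ^^ a) (p (p x)))"
    by (metis add.commute comp_apply funpow_add)
  also have "(t ^^ a) (p (p x)) = p (q x)"
    using a P[of "p x" a] cl x by simp
  finally show ?thesis
    using tb(1)[of b] cl x by (metis inj_onD)
qed

lemma funpow_involution:
  assumes "\<And>x. x \<in> X \<Longrightarrow> t (t x) = x" "\<And>x. x \<in> X \<Longrightarrow> t x \<in> X" "x \<in> X"
  shows "(t ^^ a) ((t ^^ a) x) = x"
  using \<open>x \<in> X\<close>
proof (induction a arbitrary: x)
  case (Suc a)
  have "(t ^^ Suc a) ((t ^^ Suc a) x) = t ((t ^^ a) ((t ^^ a) (t x)))"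
    by (simp add: funpow_swap1)
  then show ?case using Suc assms by simp
qed simp

section \<open>Braid relations on at most five points\<close>

text \<open>On at most two fixed points everything commutes. There are at most two nontrivial
  cycles, so \<open>p\<close> and \<open>q\<close> permute these alike and agree on \<open>M\<close>
  up to powers of \<open>t\<close>. Either \<open>p\<close> preserves each cycle and the maps
  commute, or \<open>p\<close> swaps two cycles, which then have length 2, and \<open>t\<close> is
  an involution on \<open>M\<close>.\<close>

lemma braid_pair_eq_on_card_le_5:
  fixes t :: "'a \<Rightarrow> 'a"
  assumes fin: "finite X" and card: "card X \<le> 5"
    and t: "t permutes X" and fixed: "card {x \<in> X. t x = x} \<le> 2"
    and p: "bij_betw p X X" and q: "bij_betw q X X"
    and pt: "\<And>x. x \<in> X \<Longrightarrow> p (t x) = t (p x)" and qt: "\<And>x. x \<in> X \<Longrightarrow> q (t x) = t (q x)"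
    and braid: "\<And>x. x \<in> X \<Longrightarrow> p (q (p x)) = q (p (q x))"
    and x: "x \<in> X"
  shows "p x = q x"
proof -
  define F where "F = {x \<in> X. t x = x}"
  define M where "M = {x \<in> X. t x \<noteq> x}"
  have perm: "permutation t" using t fin permutation_permutes by metis
  have cl: "t y \<in> X" "p y \<in> X" "q y \<in> X" if "y \<in> X" for y
    using permutes_in_image[OF t] p q that bij_betwE by metis+
  have inj: "inj_on p X" "inj_on q X" "inj t"
    using p q permutes_inj[OF t] by (auto simp: bij_betw_def)
  have F: "F \<subseteq> X" "finite F" and M: "M \<subseteq> X" "finite M"
    using fin by (auto simp: F_def M_def)
  have pF: "p y \<in> F" "q y \<in> F" if "y \<in> F" for y
    using that cl pt[of y] qt[of y] by (auto simp: F_def)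
  have pM: "p y \<in> M" "q y \<in> M" "t y \<in> M" if "y \<in> M" for y
  proof -
    have y: "y \<in> X" "t y \<noteq> y" using that by (auto simp: M_def)
    have "p (t y) \<noteq> p y" "q (t y) \<noteq> q y" "t (t y) \<noteq> t y"
      using inj y cl(1)[OF y(1)] inj_on_eq_iff by (metis UNIV_I)+
    then show "p y \<in> M" "q y \<in> M" "t y \<in> M"
      using y cl pt qt by (auto simp: M_def)
  qed
  note PF = bij_betw_closed_subset[OF fin p F(1) pF(1)] bij_betw_closed_subset[OF fin q F(1) pF(2)]
  note PM = bij_betw_closed_subset[OF fin p M(1) pM(1)] bij_betw_closed_subset[OF fin q M(1) pM(2)]
  show ?thesis
  proof (cases "x \<in> F")
    case True
    show ?thesis
      by (rule commuting_braid_eq[OF PF])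
        (use True F braid fixed bij_betw_card_le_2(1)[OF F(2) _ PF] in \<open>auto simp: F_def\<close>)
  next
    case False
    then have xM: "x \<in> M" using x by (simp add: F_def M_def)
    define B where "B = orbit t ` M"
    have img: "p ` orbit t y = orbit t (p y)" "q ` orbit t y = orbit t (q y)" if "y \<in> M" for y
      using that M image_orbit_commute[OF t fin] pt qt by (metis subsetD)+
    have "finite B" using M by (simp add: B_def)
    have "2 * card B \<le> card M"
      using card_orbits_moved[OF t fin] by (simp add: M_def B_def)
    moreover have "card M \<le> 5"
      using card_mono[OF fin M(1)] card by simp
    ultimately have "card B \<le> 2" by simp
    have bijB: "bij_betw ((`) h) B B"
      if h: "bij_betw h M M" "\<And>y. y \<in> M \<Longrightarrow> h ` orbit t y = orbit t (h y)" for h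
    proof -
      have "(`) h ` B = orbit t ` h ` M"
        unfolding B_def using h(2) by (simp add: image_image)
      also have "\<dots> = B"
        using h(1) by (simp add: B_def bij_betw_def)
      finally show ?thesis
        using \<open>finite B\<close> by (simp add: bij_betw_def finite_surj_inj)
    qed
    note PB = bijB[OF PM(1) img(1)] bijB[OF PM(2) img(2)]
    have B: "orbit t y \<in> B" if "y \<in> M" for y using that by (simp add: B_def)
    have "p ` C = q ` C" if "C \<in> B" for C
    proof (rule commuting_braid_eq[OF PB _ _ that])
      show "p ` q ` D = q ` p ` D" if "D \<in> B" for D
        by (rule bij_betw_card_le_2[OF \<open>finite B\<close> \<open>card B \<le> 2\<close> PB that])
      show "p ` q ` p ` D = q ` p ` q ` D" if "D \<in> B" for D
      proof -
        obtain y where "y \<in> M" "D = orbit t y" using \<open>D \<in> B\<close> by (auto simp: B_def)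
        then show ?thesis using img pM braid M by (metis subsetD)
      qed
    qed
    then have "orbit t (q y) = orbit t (p y)" if "y \<in> M" for y
      using img B that by metis
    then have qp: "\<exists>a. q y = (t ^^ a) (p y)" if "y \<in> M" for y
      using that orbit_eq_iff[OF perm] by blast
    \<comment> \<open>A permutation of at most two cycles has trivial square, so
      \<open>p (p y)\<close> lies in the cycle of \<open>y\<close>.\<close>
    have "orbit t (p (p y)) = orbit t y" if "y \<in> M" for y
      using bij_betw_card_le_2(2)[OF \<open>finite B\<close> \<open>card B \<le> 2\<close> PB B[OF that]] img that pM by metis
    then have pp: "\<exists>c. p (p y) = (t ^^ c) y" if "y \<in> M" for y
      using that orbit_eq_iff[OF perm] by blast
    have tM: "y \<in> M \<Longrightarrow> p (t y) = t (p y)" "y \<in> M \<Longrightarrow> q (t y) = t (q y)" for y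
      using pt qt M by auto
    note P = commute_funpow[of M p t, OF tM(1) pM(3)] and Q = commute_funpow[of M q t, OF tM(2) pM(3)]
    show ?thesis
    proof (cases "\<forall>y\<in>M. orbit t (p y) = orbit t y")
      case True
      \<comment> \<open>On the cycle of \<open>y\<close> the map \<open>p\<close> is a power of
        \<open>t\<close>, and so is \<open>q\<close>.\<close>
      have comm: "p (q y) = q (p y)" if "y \<in> M" for y
      proof -
        obtain a where a: "q y = (t ^^ a) (p y)" using qp \<open>y \<in> M\<close> by blast
        obtain c where c: "p y = (t ^^ c) y" using True orbit_eq_iff[OF perm] \<open>y \<in> M\<close> by blast
        have "p (q y) = (t ^^ a) (p (p y))"
          using a P pM \<open>y \<in> M\<close> by simp
        also have "p (p y) = (t ^^ c) (p y)"
          using c P \<open>y \<in> M\<close> by metis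
        also have "(t ^^ a) ((t ^^ c) (p y)) = (t ^^ c) ((t ^^ a) (p y))"
          by (metis add.commute comp_apply funpow_add)
        also have "\<dots> = q (p y)"
          using a c Q \<open>y \<in> M\<close> by metis
        finally show ?thesis .
      qed
      show ?thesis
        by (rule commuting_braid_eq[OF PM comm]) (use M braid xM in auto)
    next
      case False
      then obtain z where z: "z \<in> M" "orbit t (p z) \<noteq> orbit t z" by blast
      have self: "y \<in> orbit t y" for y using permutation_self_in_orbit[OF perm] .
      have eq: "orbit t y = orbit t w" if "y \<in> orbit t w" for y w
        using orbit_cyclic_eq3[OF cyclic_on_orbit'[OF perm] that] .
      have sub: "orbit t y \<subseteq> M" if "y \<in> M" for y
      proof
        fix w assume "w \<in> orbit t y"
        then show "w \<in> M" by induction (use that pM in auto)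
      qed
      have disj: "orbit t (p z) \<inter> orbit t z = {}" using eq z by blast
      \<comment> \<open>Two disjoint cycles of equal length fit into five points only if that length
        is at most 2.\<close>
      have "card (orbit t (p z)) = card (orbit t z)"
        using img(1)[OF z(1)] card_image[OF inj_on_subset[OF inj(1), of "orbit t z"]] sub[OF z(1)] M
        by (metis subset_trans)
      moreover have "card (orbit t (p z)) + card (orbit t z) \<le> card M"
        using card_Un_disjoint[OF _ _ disj] finite_orbit[OF self] sub z pM card_mono[OF M(2)]
        by (metis Un_subset_iff)
      ultimately have small: "card (orbit t z) \<le> 2" "card (orbit t (p z)) \<le> 2"
        using \<open>card M \<le> 5\<close> by auto
      have "{orbit t z, orbit t (p z)} \<subseteq> B" "card {orbit t z, orbit t (p z)} = 2"
        using z pM by (auto simp: B_def card_2_iff)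
      then have Beq: "{orbit t z, orbit t (p z)} = B"
        using card_seteq[OF \<open>finite B\<close>] \<open>card B \<le> 2\<close> by metis
      \<comment> \<open>The cycles of \<open>z\<close> and \<open>p z\<close> exhaust
        \<open>B\<close>, so every cycle in \<open>M\<close> has exactly two points.\<close>
      have tt: "t (t y) = y" if "y \<in> M" for y
      proof -
        have "orbit t y = orbit t z \<or> orbit t y = orbit t (p z)"
          using Beq B[OF that] by blast
        then have "card (orbit t y) \<le> 2" using small by metis
        moreover have "{y, t y} \<subseteq> orbit t y" using self orbit.base by fast
        moreover have ne: "card {y, t y} = 2" using that by (auto simp: M_def card_2_iff)
        ultimately have "{y, t y} = orbit t y"
          using card_seteq[OF finite_orbit[OF self], of "{y, t y}"] by simp
        moreover have "t (t y) \<in> orbit t y" by (intro orbit.intros)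
        moreover have "t (t y) \<noteq> t y" using pM(3)[OF that] by (simp add: M_def)
        ultimately show ?thesis by blast
      qed
      have "q (p y) = p (p y)" if y: "y \<in> M" for y
      proof -
        obtain a where a: "q y = (t ^^ a) (p y)" using qp y by blast
        obtain b where b: "q (p y) = (t ^^ b) (p (p y))" using qp[OF pM(1)[OF y]] by blast
        obtain c where c: "p (p y) = (t ^^ c) y" using pp y by blast
        have tn: "(t ^^ k) w \<in> M" if "w \<in> M" for k w
          using that pM by (induction k) auto
        \<comment> \<open>As \<open>p (p y)\<close> lies in the cycle of \<open>y\<close>, the
          exponent \<open>a\<close> found at \<open>y\<close> is also valid there.\<close>
        have qc: "q (p (p y)) = (t ^^ a) (p (p (p y)))"
        proof -
          have "q (p (p y)) = (t ^^ c) (q y)" using c Q y by metis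
          also have "\<dots> = (t ^^ a) ((t ^^ c) (p y))"
            unfolding a by (metis add.commute comp_apply funpow_add)
          also have "(t ^^ c) (p y) = p (p (p y))" using c P y by metis
          finally show ?thesis .
        qed
        \<comment> \<open>The two factors \<open>t ^^ a\<close> cancel because \<open>t\<close> is
          an involution on \<open>M\<close>. Comparison with the braid relation then leaves a common
          \<open>p\<close> to be cancelled.\<close>
        have "q (p (q y)) = (t ^^ a) (q (p (p y)))"
          unfolding a using P Q pM y by simp
        also have "\<dots> = p (p (p y))"
          unfolding qc by (rule funpow_involution[of M]) (use tt pM y in auto)
        finally have "p (q (p y)) = p (p (p y))"
          using braid y M by auto
        then show ?thesis
          using inj_onD[OF bij_betw_imp_inj_on[OF PM(1)], of "q (p y)" "p (p y)"] pM y by simp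
      qed
      moreover obtain y where "y \<in> M" "x = p y"
        using PM(1) xM unfolding bij_betw_def by blast
      ultimately show ?thesis by simp
    qed
  qed
qed

text \<open>The braid relation says that \<open>p \<circ> q\<close> conjugates \<open>p\<close> into
  \<open>q\<close>, hence it maps the points moved by \<open>p\<close> injectively to points moved
  by \<open>q\<close>.\<close>

lemma card_moved_le:
  assumes fin: "finite X" and p: "bij_betw p X X" and q: "bij_betw q X X"
    and braid: "\<And>x. x \<in> X \<Longrightarrow> p (q (p x)) = q (p (q x))"
  shows "card {x \<in> X. p x \<noteq> x} \<le> card {x \<in> X. q x \<noteq> x}"
proof (rule card_inj_on_le[of "p \<circ> q"])
  have pq: "bij_betw (p \<circ> q) X X"
    using bij_betw_trans[OF q p] .
  then have inj: "inj_on (p \<circ> q) X" by (simp add: bij_betw_def)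
  show "inj_on (p \<circ> q) {x \<in> X. p x \<noteq> x}"
    by (rule inj_on_subset[OF inj]) auto
  show "(p \<circ> q) ` {x \<in> X. p x \<noteq> x} \<subseteq> {x \<in> X. q x \<noteq> x}"
  proof
    fix z assume "z \<in> (p \<circ> q) ` {x \<in> X. p x \<noteq> x}"
    then obtain x where x: "x \<in> X" "p x \<noteq> x" "z = p (q x)" by auto
    have "p x \<in> X" using p x bij_betwE by metis
    then have "p (q (p x)) \<noteq> p (q x)"
      using inj_on_eq_iff[OF inj, of "p x" x] x by simp
    then have "q z \<noteq> z" using braid x by simp
    moreover have "z \<in> X" using bij_betwE[OF pq] x by auto
    ultimately show "z \<in> {x \<in> X. q x \<noteq> x}" by simp
  qed
  show "finite {x \<in> X. q x \<noteq> x}" using fin by simp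
qed

text \<open>Both maps are transpositions. By commutation \<open>q\<close> preserves the pair moved
  by \<open>p\<close>, so \<open>q z\<close>, being different from \<open>z\<close>, must be
  \<open>p z\<close>.\<close>

lemma commuting_moving_two_eq:
  assumes p: "bij_betw p X X" and q: "bij_betw q X X"
    and comm: "\<And>x. x \<in> X \<Longrightarrow> p (q x) = q (p x)"
    and cardp: "card {x \<in> X. p x \<noteq> x} = 2" and cardq: "card {x \<in> X. q x \<noteq> x} = 2"
    and z: "z \<in> X" "p z \<noteq> z" "q z \<noteq> z" and x: "x \<in> X"
  shows "p x = q x"
proof -
  have two: "{y \<in> X. h y \<noteq> y} = {z, h z} \<and> h (h z) = z"
    if h: "bij_betw h X X" "card {y \<in> X. h y \<noteq> y} = 2" "h z \<noteq> z" for h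
  proof -
    have inj: "inj_on h X" using h by (simp add: bij_betw_def)
    have X: "h z \<in> X" "h (h z) \<in> X" using h(1) z(1) bij_betwE by metis+
    then have ne: "h (h z) \<noteq> h z" using inj h(3) z(1) by (metis inj_onD)
    then have "h (h (h z)) \<noteq> h (h z)" using inj X by (metis inj_onD)
    have sub: "{z, h z} \<subseteq> {y \<in> X. h y \<noteq> y}" using z(1) h(3) X ne by auto
    moreover have "card {z, h z} = 2" using h(3) by (auto simp: card_2_iff)
    moreover have "finite {y \<in> X. h y \<noteq> y}" by (rule card_ge_0_finite) (simp add: h)
    ultimately have "{z, h z} = {y \<in> X. h y \<noteq> y}" using h(2) card_seteq[of "{y \<in> X. h y \<noteq> y}" "{z, h z}"] by simp
    moreover have "h (h z) \<in> {y \<in> X. h y \<noteq> y}"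
      using X \<open>h (h (h z)) \<noteq> h (h z)\<close> by simp
    ultimately show ?thesis using ne by blast
  qed
  note P = two[OF p cardp z(2)] and Q = two[OF q cardq z(3)]
  have "p (q z) \<noteq> q z"
  proof -
    have "p z \<in> X" using bij_betwE[OF p] z by blast
    then have "q (p z) \<noteq> q z" using q z by (metis bij_betw_def inj_onD)
    then show ?thesis using comm z by simp
  qed
  moreover have "q z \<in> X" using bij_betwE[OF q] z by blast
  ultimately have eq: "q z = p z" using P z(3) by blast
  show ?thesis
  proof (cases "x \<in> {z, p z}")
    case True
    then show ?thesis using P Q eq by auto
  next
    case False
    then have "p x = x" "q x = x" using P Q eq x by auto
    then show ?thesis by simp
  qed
qed

section \<open>Induction on the number of strands\<close>

text \<open>An induction hypothesis has a fixed type, but the cycles of a permutation are sets.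
  Numbering the points by \<open>h\<close> reduces an action on any finite set to one on natural
  numbers.\<close>

lemma braid_action_eq_transfer:
  assumes nat: "\<And>(r :: nat \<Rightarrow> nat \<Rightarrow> nat) Y j y. \<lbrakk>finite Y; card Y < c; braid_action n r Y; 1 \<le> j; j < n; y \<in> Y\<rbrakk>
      \<Longrightarrow> r j y = r 1 y"
    and fin: "finite X" and card: "card X < c" and act: "braid_action n s X"
    and j: "1 \<le> j" "j < n" and x: "x \<in> X"
  shows "s j x = s 1 x"
proof -
  obtain h where h: "bij_betw h X {0..<card X}"
    using ex_bij_betw_finite_nat[OF fin] by blast
  have hi: "inv_into X h (h y) = y" if "y \<in> X" for y
    using that h by (simp add: bij_betw_def)
  define r where "r = (\<lambda>i y. h (s i (inv_into X h y)))"
  have "braid_action n r {0..<card X}"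
    by (rule braid_action_semiconj[OF act fin, of h]) (use h hi in \<open>auto simp: bij_betw_def r_def\<close>)
  then have "r j (h x) = r 1 (h x)"
    by (intro nat[of "{0..<card X}"]) (use card j x bij_betwE[OF h] in auto)
  then have "h (s j x) = h (s 1 x)"
    using x by (simp add: r_def hi)
  moreover have "s j x \<in> X" "s 1 x \<in> X"
    using braid_action_in[OF act] j x by auto
  ultimately show ?thesis
    using h by (metis bij_betw_def inj_onD)
qed

text \<open>Pairwise disjoint, they would have six elements together. This will be applied to the
  pairs moved by \<open>s 1\<close>, \<open>s 3\<close> and \<open>s 5\<close>.\<close>

lemma three_card_2_subsets_meet:
  assumes "finite X" "card X \<le> 5" "A \<subseteq> X" "B \<subseteq> X" "C \<subseteq> X" "card A = 2" "card B = 2" "card C = 2"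
  shows "A \<inter> B \<noteq> {} \<or> B \<inter> C \<noteq> {} \<or> A \<inter> C \<noteq> {}"
proof (rule ccontr)
  assume *: "\<not> ?thesis"
  have fin: "finite A" "finite B" "finite C"
    using assms finite_subset by blast+
  have "card (A \<union> B \<union> C) = card (A \<union> B) + card C"
    by (rule card_Un_disjoint) (use * fin in auto)
  also have "card (A \<union> B) = card A + card B"
    by (rule card_Un_disjoint) (use * fin in auto)
  finally have "card (A \<union> B \<union> C) = 6" using assms by simp
  moreover have "card (A \<union> B \<union> C) \<le> card X"
    by (rule card_mono) (use assms in auto)
  ultimately show False using assms(2) by simp
qed

lemma braid_action_eq_nat:
  fixes s :: "nat \<Rightarrow> nat \<Rightarrow> nat"
  assumes "5 \<le> n" "finite X" "card X < n" "braid_action n s X" "1 \<le> j" "j < n" "x \<in> X"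
  shows "s j x = s 1 x"
  using assms
proof (induction n arbitrary: s X j x rule: less_induct)
  case (less n)
  note n = less.prems(1) and fin = less.prems(2) and card = less.prems(3) and act = less.prems(4)
  note bij = braid_action_bij[OF act] and far = braid_action_far[OF act]
    and near = braid_action_near[OF act] and closed = braid_action_in[OF act]
  \<comment> \<open>It suffices that one neighbouring pair commutes: by the braid relation it then
    coincides, and the equality spreads to all generators.\<close>
  have goal: ?case if k: "1 \<le> k" "k + 2 \<le> n" and comm: "\<And>y. y \<in> X \<Longrightarrow> s k (s (Suc k) y) = s (Suc k) (s k y)" for k
  proof (rule braid_action_all_eq[OF act k])
    show "s k y = s (Suc k) y" if "y \<in> X" for y
    proof (rule commuting_braid_eq[of "s k" X "s (Suc k)"])
      show "bij_betw (s k) X X" "bij_betw (s (Suc k)) X X"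
        by (rule bij; use k in simp)+
    qed (fact near[OF k] comm that)+
  qed (use less.prems in auto)
  \<comment> \<open>The values of \<open>s (n - 1)\<close> outside \<open>X\<close> are arbitrary.
    Replacing them by the identity yields a genuine permutation, whose orbits are its
    cycles.\<close>
  define t where "t = perm_restrict (s (n - 1)) X"
  have t_eq: "t y = s (n - 1) y" if "y \<in> X" for y
    using that by (simp add: t_def perm_restrict_simps)
  have bijt: "bij_betw t X X"
    using bij[of "n - 1"] n bij_betw_cong[of X t "s (n - 1)" X] t_eq by simp
  then have t: "t permutes X"
    by (rule bij_imp_permutes) (simp add: t_def perm_restrict_simps)
  have perm: "permutation t" using t fin permutation_permutes by metis
  have tX: "t y \<in> X" if "y \<in> X" for y using permutes_in_image[OF t] that by simp
  \<comment> \<open>The bound \<open>i < n - 2\<close> keeps \<open>i\<close> at distance at least 2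
    from \<open>n - 1\<close>.\<close>
  have ct: "s i (t y) = t (s i y)" if "1 \<le> i" "i < n - 2" "y \<in> X" for i y
    using far[of i "n - 1" y] closed[of i y] that t_eq by simp
  define F where "F = {y \<in> X. t y = y}"
  define M where "M = {y \<in> X. t y \<noteq> y}"
  have F: "F \<subseteq> X" and M: "M \<subseteq> X" "finite M" using fin by (auto simp: F_def M_def)
  have cardFM: "card X = card F + card M"
  proof -
    have "card (F \<union> M) = card F + card M"
      by (rule card_Un_disjoint) (use fin in \<open>auto simp: F_def M_def\<close>)
    moreover have "F \<union> M = X" by (auto simp: F_def M_def)
    ultimately show ?thesis by simp
  qed
  have pF: "s i y \<in> F" if "1 \<le> i" "i < n - 2" "y \<in> F" for i y
    using ct[of i y] closed[of i y] that by (simp add: F_def)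
  have pM: "s i y \<in> M" if "1 \<le> i" "i < n - 2" "y \<in> M" for i y
  proof -
    have y: "y \<in> X" "t y \<noteq> y" using that by (auto simp: M_def)
    have "inj_on (s i) X" using bij[of i] that by (simp add: bij_betw_def)
    then have "s i (t y) \<noteq> s i y" using y tX inj_on_eq_iff by metis
    then show ?thesis using ct[of i y] closed[of i y] that y by (simp add: M_def)
  qed
  show ?case
  proof (cases "M = {}")
    case True
    \<comment> \<open>If \<open>s (n - 1)\<close> acts trivially, it commutes with its neighbour
      \<open>s (n - 2)\<close>.\<close>
    then have id: "s (n - 1) y = y" if "y \<in> X" for y
      using that t_eq by (auto simp: M_def)
    show ?thesis
    proof (rule goal[of "n - 2"])
      have n2: "Suc (n - 2) = n - 1" using n by simp
      show "s (n - 2) (s (Suc (n - 2)) y) = s (Suc (n - 2)) (s (n - 2) y)" if "y \<in> X" for y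
        unfolding n2 using id closed[of "n - 2" y] n that by simp
    qed (use n in auto)
  next
    case False
    then obtain z where z: "z \<in> M" by blast
    have "{z, t z} \<subseteq> M"
      using z tX permutes_inj[OF t] by (auto simp: M_def inj_def)
    moreover have "card {z, t z} = 2" using z by (auto simp: M_def card_2_iff)
    ultimately have M2: "2 \<le> card M" using card_mono[OF M(2)] by metis
    show ?thesis
    proof (cases "7 \<le> n")
      case True
      \<comment> \<open>From \<open>n \<ge> 7\<close> one gets \<open>n - 2 \<ge> 5\<close>, as the
        induction hypothesis demands.\<close>
      have IH: "r j y = r 1 y"
        if "finite Y" "card Y < n - 2" "braid_action (n - 2) r Y" "1 \<le> j" "j < n - 2" "y \<in> Y"
        for r :: "nat \<Rightarrow> nat \<Rightarrow> nat" and Y j y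
        by (rule less.IH) (use that True in auto)
      have act': "braid_action (n - 2) s X" by (rule braid_action_mono[OF act]) simp
      have onF: "s j y = s 1 y" if "1 \<le> j" "j < n - 2" "y \<in> F" for j y
      proof (rule IH)
        show "braid_action (n - 2) s F"
          by (rule braid_action_subset[OF act' fin F pF])
        \<comment> \<open>At least two points are moved, so at most \<open>card X - 2\<close> are
          fixed.\<close>
        show "card F < n - 2" using cardFM M2 card by linarith
      qed (use that fin in \<open>auto simp: F_def\<close>)
      define B where "B = orbit t ` M"
      have img: "s i ` orbit t y = orbit t (s i y)" if "1 \<le> i" "i < n - 2" "y \<in> M" for i y
        by (rule image_orbit_commute[OF t fin]) (use that ct M in auto)
      have actB: "braid_action (n - 2) (\<lambda>i. (`) (s i)) B"
        by (rule braid_action_semiconj[of _ s M "orbit t"])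
          (use braid_action_subset[OF act' fin M(1) pM] M img in \<open>auto simp: B_def\<close>)
      \<comment> \<open>\<open>B\<close> has at most half as many elements as \<open>M\<close>,
        hence at most \<open>(n - 1) / 2\<close>, which is below \<open>n - 2\<close>.\<close>
      have cardB: "card B < n - 2"
        using card_orbits_moved[OF t fin] card cardFM True by (simp add: M_def B_def)
      have finB: "finite B" using M by (simp add: B_def)
      have onB: "s j ` C = s 1 ` C" if "1 \<le> j" "j < n - 2" "C \<in> B" for j C
        using braid_action_eq_transfer[of "n - 2" "n - 2" B "\<lambda>i. (`) (s i)" j C] IH finB cardB actB that
        by blast
      \<comment> \<open>Lying in the same cycle of \<open>t\<close> means being equal up to a power
        of \<open>t\<close>; on fixed points of \<open>t\<close> the exponent is 0.\<close>
      have modulo: "\<exists>a. s j y = (t ^^ a) (s 1 y)" if j: "1 \<le> j" "j < n - 2" and y: "y \<in> X" for j y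
      proof (cases "y \<in> M")
        case True
        have "orbit t (s j y) = orbit t (s 1 y)"
          using onB[OF j, of "orbit t y"] img[of j y] img[of 1 y] True j by (simp add: B_def)
        then show ?thesis using orbit_eq_iff[OF perm] by blast
      next
        case False
        then have "y \<in> F" using y by (simp add: F_def M_def)
        then have "s j y = (t ^^ 0) (s 1 y)" using onF[OF j] by simp
        then show ?thesis by blast
      qed
      show ?thesis
      proof (rule goal[of 1])
        \<comment> \<open>\<open>s 4\<close> commutes with \<open>s 1\<close> and \<open>s 2\<close>
          and also with \<open>t\<close>, because \<open>4 < n - 2\<close>; this is again the bound
          \<open>n \<ge> 7\<close>.\<close>
        show "s 1 (s (Suc 1) y) = s (Suc 1) (s 1 y)" if "y \<in> X" for y
        proof (rule commute_of_eq_modulo_powers[of t X "s 1" "s (Suc 1)" "s 4"])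
          show "bij_betw (s 1) X X" "bij_betw (s (Suc 1)) X X" "bij_betw (s 4) X X"
            by (rule bij; use True in simp)+
          show "s 1 (t y) = t (s 1 y)" "s (Suc 1) (t y) = t (s (Suc 1) y)" "s 4 (t y) = t (s 4 y)"
            if "y \<in> X" for y
            by (rule ct; use True that in simp)+
          show "s 4 (s 1 y) = s 1 (s 4 y)" "s 4 (s (Suc 1) y) = s (Suc 1) (s 4 y)" if "y \<in> X" for y
            by (rule far; use True that in simp)+
          show "\<exists>a. s (Suc 1) y = (t ^^ a) (s 1 y)" "\<exists>a. s 4 y = (t ^^ a) (s 1 y)" if "y \<in> X" for y
            by (rule modulo; use True that in simp)+
        qed (fact bijt that)+
      qed (use True in auto)
    next
      case False
      then have X5: "card X \<le> 5" using card by simp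
      show ?thesis
      proof (cases "card F \<le> 2")
        case True
        \<comment> \<open>Both \<open>s 1\<close> and \<open>s 2\<close> commute with
          \<open>t\<close> because \<open>2 < n - 2\<close>.\<close>
        have e: "s 1 y = s (Suc 1) y" if "y \<in> X" for y
        proof (rule braid_pair_eq_on_card_le_5[OF fin X5 t, of "s 1" "s (Suc 1)"])
          show "card {x \<in> X. t x = x} \<le> 2" using True by (simp add: F_def)
          show "bij_betw (s 1) X X" "bij_betw (s (Suc 1)) X X"
            by (rule bij; use n in simp)+
          show "s 1 (t y) = t (s 1 y)" "s (Suc 1) (t y) = t (s (Suc 1) y)" if "y \<in> X" for y
            by (rule ct; use n that in simp)+
          show "s 1 (s (Suc 1) (s 1 y)) = s (Suc 1) (s 1 (s (Suc 1) y))" if "y \<in> X" for y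
            by (rule near) (use n that in auto)
        qed (fact that)
        show ?thesis
          by (rule braid_action_all_eq[OF act, of 1, OF _ _ e]) (use less.prems n in auto)
      next
        case F3: False
        define m where "m = (\<lambda>i. {y \<in> X. s i y \<noteq> y})"
        \<comment> \<open>Three fixed and two moved points exhaust the at most five points, so
          \<open>X\<close> has five points and \<open>t\<close> is a transposition.\<close>
        have n6: "n = 6" and M_card: "card M = 2"
          using cardFM F3 M2 X5 card False by linarith+
        have "m 5 = M"
          unfolding m_def M_def using t_eq n6 by auto
        then have m5: "card (m 5) = 2" using M_card by simp
        \<comment> \<open>Neighbouring generators are conjugate, so all of them move two
          points.\<close>
        have step: "card (m i) = card (m (Suc i))" if "1 \<le> i" "i + 2 \<le> n" for i
        proof (rule antisym)
          have b: "bij_betw (s i) X X" "bij_betw (s (Suc i)) X X"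
            by (rule bij; use that in simp)+
          show "card (m i) \<le> card (m (Suc i))" "card (m (Suc i)) \<le> card (m i)"
            unfolding m_def
            by (rule card_moved_le[OF fin b near] card_moved_le[OF fin b(2,1) near[symmetric]];
                use that in simp)+
        qed
        have m: "card (m 1) = 2" "card (m 3) = 2"
          using m5 step[of 1] step[of 2] step[of 3] step[of 4] n6 by (simp_all add: eval_nat_numeral)
        have eq: "\<forall>y\<in>X. s i y = s j y"
          if ij: "card (m i) = 2" "card (m j) = 2" "m i \<inter> m j \<noteq> {}" "1 \<le> i" "i + 2 \<le> j" "j < n" for i j
        proof
          obtain z where z: "z \<in> X" "s i z \<noteq> z" "s j z \<noteq> z" using ij(3) by (auto simp: m_def)
          fix y assume "y \<in> X"
          show "s i y = s j y"
            by (rule commuting_moving_two_eq[of "s i" X "s j" z])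
              (use z \<open>y \<in> X\<close> ij bij[of i] bij[of j] far[of i j] in \<open>auto simp: m_def\<close>)
        qed
        \<comment> \<open>Among five points two of these three pairs meet, and the two commuting
          transpositions concerned coincide.\<close>
        have "m 1 \<inter> m 3 \<noteq> {} \<or> m 3 \<inter> m 5 \<noteq> {} \<or> m 1 \<inter> m 5 \<noteq> {}"
          by (rule three_card_2_subsets_meet[OF fin X5]) (use m m5 in \<open>auto simp: m_def\<close>)
        then consider "\<forall>y\<in>X. s 1 y = s 3 y" | "\<forall>y\<in>X. s 3 y = s 5 y" | "\<forall>y\<in>X. s 1 y = s 5 y"
          using eq[of 1 3] eq[of 3 5] eq[of 1 5] m m5 n6 by fastforce
        \<comment> \<open>In each case a generator inherits commutation with a neighbour:
          \<open>s 3\<close> inherits from \<open>s 1\<close> that with \<open>s 4\<close>, and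
          \<open>s 3\<close> or \<open>s 1\<close> inherits from \<open>s 5\<close> that with
          \<open>s 2\<close>.\<close>
        then show ?thesis
        proof cases
          case 1
          show ?thesis
          proof (rule goal[of 3])
            show "s 3 (s (Suc 3) y) = s (Suc 3) (s 3 y)" if "y \<in> X" for y
              using far[of 1 4 y] closed[of 4 y] 1 that n6 by simp
          qed (use n6 in auto)
        next
          case 2
          show ?thesis
          proof (rule goal[of 2])
            show "s 2 (s (Suc 2) y) = s (Suc 2) (s 2 y)" if "y \<in> X" for y
              using far[of 5 2 y] closed[of 2 y] 2 that n6 by simp
          qed (use n6 in auto)
        next
          case 3
          show ?thesis
          proof (rule goal[of 1])
            show "s 1 (s (Suc 1) y) = s (Suc 1) (s 1 y)" if "y \<in> X" for y
              using far[of 5 2 y] closed[of 2 y] 3 that n6 by (simp add: eval_nat_numeral)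
          qed (use n6 in auto)
        qed
      qed
    qed
  qed
qed

lemma braid_action_eq:
  assumes "5 \<le> n" "finite X" "card X < n" "braid_action n s X" "1 \<le> j" "j < n" "x \<in> X"
  shows "s j x = s 1 x"
  using braid_action_eq_transfer[of n n X s j x] braid_action_eq_nat[OF assms(1)] assms(2-) by blast


section \<open>Centralisers and the lower central series\<close>

lemma centraliserI:
  "\<lbrakk>x \<in> carrier G; \<And>h. h \<in> H \<Longrightarrow> x \<otimes>\<^bsub>G\<^esub> h = h \<otimes>\<^bsub>G\<^esub> x\<rbrakk> \<Longrightarrow> x \<in> centraliser G H"
  unfolding centraliser_def by blast

lemma centraliserD:
  "x \<in> centraliser G H \<Longrightarrow> h \<in> H \<Longrightarrow> x \<otimes>\<^bsub>G\<^esub> h = h \<otimes>\<^bsub>G\<^esub> x"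
  unfolding centraliser_def by blast

lemma centraliser_carrier: "x \<in> centraliser G H \<Longrightarrow> x \<in> carrier G"
  unfolding centraliser_def by blast

context group
begin

lemma inv_commute:
  assumes "x \<otimes> h = h \<otimes> x" "x \<in> carrier G" "h \<in> carrier G"
  shows "inv x \<otimes> h = h \<otimes> inv x"
proof -
  have "x \<otimes> (h \<otimes> inv x) = h \<otimes> x \<otimes> inv x"
    using assms by (simp flip: assms(1) m_assoc)
  also have "\<dots> = h"
    using assms(2,3) by (simp add: m_assoc)
  finally show ?thesis
    using assms by (simp add: inv_solve_left')
qed

lemma subgroup_centraliser:
  assumes A: "A \<subseteq> carrier G"
  shows "subgroup (centraliser G A) G"
proof (rule subgroupI)
  show "centraliser G A \<subseteq> carrier G"
    by (auto dest: centraliser_carrier)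
  have "\<one> \<in> centraliser G A"
    by (rule centraliserI) (use A in auto)
  then show "centraliser G A \<noteq> {}" by blast
  show "inv x \<in> centraliser G A" if "x \<in> centraliser G A" for x
    using centraliser_carrier[OF that] inv_commute[OF centraliserD[OF that]] A
    by (intro centraliserI) auto
  show "x \<otimes> y \<in> centraliser G A" if x: "x \<in> centraliser G A" and y: "y \<in> centraliser G A" for x y
  proof (rule centraliserI)
    note car = centraliser_carrier[OF x] centraliser_carrier[OF y]
    then show "x \<otimes> y \<in> carrier G" by simp
    fix h assume h: "h \<in> A"
    then have hc: "h \<in> carrier G" using A by blast
    have "x \<otimes> y \<otimes> h = x \<otimes> (h \<otimes> y)"
      using car hc centraliserD[OF y h] by (simp add: m_assoc)
    also have "\<dots> = h \<otimes> x \<otimes> y"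
      using car hc centraliserD[OF x h] by (simp flip: m_assoc)
    also have "\<dots> = h \<otimes> (x \<otimes> y)"
      using car hc by (simp add: m_assoc)
    finally show "x \<otimes> y \<otimes> h = h \<otimes> (x \<otimes> y)" .
  qed
qed

text \<open>The elements commuting with a given \<open>x\<close> form a subgroup, which contains
  \<open>generate G A\<close> as soon as it contains \<open>A\<close>.\<close>

lemma centraliser_generate:
  assumes A: "A \<subseteq> carrier G"
  shows "centraliser G (generate G A) = centraliser G A"
proof
  show "centraliser G (generate G A) \<subseteq> centraliser G A"
    using generate.incl[of _ A G] unfolding centraliser_def by blast
  show "centraliser G A \<subseteq> centraliser G (generate G A)"
  proof
    fix x assume x: "x \<in> centraliser G A"
    have "A \<subseteq> centraliser G {x}"
      using A centraliserD[OF x] unfolding centraliser_def by fastforce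
    then have "generate G A \<subseteq> centraliser G {x}"
      using centraliser_carrier[OF x] by (intro generate_subgroup_incl subgroup_centraliser) auto
    then show "x \<in> centraliser G (generate G A)"
      using centraliser_carrier[OF x] unfolding centraliser_def by fastforce
  qed
qed

section \<open>Commutators modulo the centre\<close>

text \<open>The \<open>x\<close> that commute with \<open>u\<close> up to a central factor form a
  subgroup. Keeping the factor \<open>z\<close> explicit avoids passing to the quotient by the
  centre.\<close>

lemma commute_modulo_centre_generate:
  assumes A: "A \<subseteq> carrier G" and gen: "generate G A = carrier G" and u: "u \<in> carrier G"
    and ex: "\<And>x. x \<in> A \<Longrightarrow> \<exists>z\<in>centraliser G (carrier G). x \<otimes> u = z \<otimes> (u \<otimes> x)"
    and x: "x \<in> carrier G"
  shows "\<exists>z\<in>centraliser G (carrier G). x \<otimes> u = z \<otimes> (u \<otimes> x)"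
proof -
  interpret Z: subgroup "centraliser G (carrier G)" G
    by (rule subgroup_centraliser) simp
  have comm: "z \<otimes> y = y \<otimes> z" if "z \<in> centraliser G (carrier G)" "y \<in> carrier G" for y z
    using centraliserD that by fast
  have "x \<in> generate G A" using gen x by simp
  then show ?thesis
  proof induction
    case one
    show ?case using u by (intro bexI[of _ \<one>]) auto
  next
    case (incl h)
    then show ?case by (rule ex)
  next
    case (inv h)
    then have h: "h \<in> carrier G" using A by blast
    obtain z where z: "z \<in> centraliser G (carrier G)" "h \<otimes> u = z \<otimes> (u \<otimes> h)"
      using ex inv by blast
    have zc: "z \<in> carrier G" by (rule Z.mem_carrier[OF z(1)])
    have "inv h \<otimes> u = inv z \<otimes> (u \<otimes> inv h)"
    proof (subst inv_solve_left')
      have "u = inv z \<otimes> (h \<otimes> u \<otimes> inv h)"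
        using z h u zc by (simp add: m_assoc inv_solve_left)
      also have "\<dots> = inv z \<otimes> h \<otimes> (u \<otimes> inv h)"
        using h u zc by (simp add: m_assoc)
      also have "inv z \<otimes> h = h \<otimes> inv z"
        using comm[OF Z.m_inv_closed[OF z(1)] h] .
      finally show "u = h \<otimes> (inv z \<otimes> (u \<otimes> inv h))"
        using h u zc by (simp add: m_assoc)
    qed (use h u zc in auto)
    then show ?case using Z.m_inv_closed[OF z(1)] by blast
  next
    case (eng h k)
    have hk: "h \<in> carrier G" "k \<in> carrier G"
      using eng generate_in_carrier[OF A] by auto
    obtain z where z: "z \<in> centraliser G (carrier G)" "h \<otimes> u = z \<otimes> (u \<otimes> h)"
      using eng by blast
    obtain w where w: "w \<in> centraliser G (carrier G)" "k \<otimes> u = w \<otimes> (u \<otimes> k)"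
      using eng by blast
    have c: "z \<in> carrier G" "w \<in> carrier G" using centraliser_carrier[OF z(1)] centraliser_carrier[OF w(1)] by auto
    have "h \<otimes> k \<otimes> u = h \<otimes> w \<otimes> (u \<otimes> k)"
      using hk u c w by (simp add: m_assoc)
    also have "h \<otimes> w = w \<otimes> h"
      using comm[OF w(1) hk(1)] by simp
    also have "w \<otimes> h \<otimes> (u \<otimes> k) = w \<otimes> (h \<otimes> u) \<otimes> k"
      using hk u c by (simp add: m_assoc)
    also have "\<dots> = (w \<otimes> z) \<otimes> (u \<otimes> (h \<otimes> k))"
      unfolding z(2) using hk u c by (simp add: m_assoc)
    finally show ?case
      using Z.m_closed[OF w(1) z(1)] by blast
  qed
qed

text \<open>Commutation up to central factors is extended from the generators to the whole group in
  one argument, then flipped and extended in the other.\<close>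

lemma commutator_central:
  assumes A: "A \<subseteq> carrier G" and gen: "generate G A = carrier G"
    and ex: "\<And>x y. \<lbrakk>x \<in> A; y \<in> A\<rbrakk> \<Longrightarrow> \<exists>z\<in>centraliser G (carrier G). x \<otimes> y = z \<otimes> (y \<otimes> x)"
    and xy: "x \<in> carrier G" "y \<in> carrier G"
  shows "x \<otimes> y \<otimes> inv x \<otimes> inv y \<in> centraliser G (carrier G)"
proof -
  interpret Z: subgroup "centraliser G (carrier G)" G
    by (rule subgroup_centraliser) simp
  have flip: "\<exists>z\<in>centraliser G (carrier G). y \<otimes> x = z \<otimes> (x \<otimes> y)"
    if ex: "\<exists>z\<in>centraliser G (carrier G). x \<otimes> y = z \<otimes> (y \<otimes> x)"
      and xy: "x \<in> carrier G" "y \<in> carrier G" for x y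
  proof -
    obtain z where z: "z \<in> centraliser G (carrier G)" "x \<otimes> y = z \<otimes> (y \<otimes> x)"
      using ex by blast
    have "y \<otimes> x = inv z \<otimes> (x \<otimes> y)"
      by (subst inv_solve_left) (use z(2) xy Z.mem_carrier[OF z(1)] in auto)
    then show ?thesis using Z.m_inv_closed[OF z(1)] by blast
  qed
  have "\<exists>z\<in>centraliser G (carrier G). a \<otimes> y = z \<otimes> (y \<otimes> a)" if "a \<in> A" for a
  proof (rule flip)
    show "\<exists>z\<in>centraliser G (carrier G). y \<otimes> a = z \<otimes> (a \<otimes> y)"
      by (rule commute_modulo_centre_generate[OF A gen]) (use that A ex xy in auto)
  qed (use that A xy in auto)
  then obtain z where z: "z \<in> centraliser G (carrier G)" "x \<otimes> y = z \<otimes> (y \<otimes> x)"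
    using commute_modulo_centre_generate[OF A gen xy(2) _ xy(1)] by blast
  have "x \<otimes> y \<otimes> inv x \<otimes> inv y = z \<otimes> (y \<otimes> x) \<otimes> inv x \<otimes> inv y"
    by (simp only: z(2))
  also have "\<dots> = z"
    using xy Z.mem_carrier[OF z(1)] by (simp add: m_assoc)
  finally show ?thesis using z by simp
qed

section \<open>The lower central series and factorisation of homomorphisms\<close>

lemma lower_central_series_subset: "lower_central_series G i \<subseteq> carrier G"
proof (induction i)
  case (Suc i)
  show ?case
  proof (cases i)
    case (Suc k)
    show ?thesis
      unfolding Suc lower_central_series.simps
      by (rule generate_incl) (use Suc \<open>lower_central_series G i \<subseteq> carrier G\<close> in auto)
  qed simp
qed simp

text \<open>Central commutators put the second term of the series into the centre, so the
  commutators generating the third are trivial.\<close>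

lemma lower_central_series_3_trivial:
  assumes "\<And>x y. \<lbrakk>x \<in> carrier G; y \<in> carrier G\<rbrakk> \<Longrightarrow> x \<otimes> y \<otimes> inv x \<otimes> inv y \<in> centraliser G (carrier G)"
  shows "lower_central_series G 3 = {\<one>}"
proof -
  have L2: "lower_central_series G 2 \<subseteq> centraliser G (carrier G)"
    unfolding numeral_2_eq_2 lower_central_series.simps
    by (rule generate_subgroup_incl[OF _ subgroup_centraliser]) (use assms in auto)
  have "x \<otimes> y \<otimes> inv x \<otimes> inv y = \<one>" if "x \<in> carrier G" "y \<in> lower_central_series G 2" for x y
  proof -
    have y: "y \<in> carrier G" "x \<otimes> y = y \<otimes> x"
      using subsetD[OF L2 that(2)] that(1) centraliser_carrier centraliserD[of y G "carrier G" x] by auto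
    have "x \<otimes> y \<otimes> inv x \<otimes> inv y = y \<otimes> x \<otimes> inv x \<otimes> inv y"
      by (simp only: y(2))
    then show ?thesis using that y by (simp add: m_assoc)
  qed
  then have "{x \<otimes> y \<otimes> inv x \<otimes> inv y |x y. x \<in> carrier G \<and> y \<in> lower_central_series G 2} \<subseteq> {\<one>}"
    by auto
  then have "lower_central_series G 3 \<subseteq> {\<one>}"
    unfolding numeral_3_eq_3 lower_central_series.simps
    by (intro generate_subgroup_incl triv_subgroup) (simp add: numeral_2_eq_2)
  moreover have "\<one> \<in> lower_central_series G 3"
    unfolding numeral_3_eq_3 lower_central_series.simps by (rule generate.one)
  ultimately show ?thesis by blast
qed

end

lemma (in group_hom) lower_central_series_image:
  "h ` lower_central_series G i \<subseteq> lower_central_series H i"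
proof (induction i rule: less_induct)
  case (less i)
  show ?case
  proof (cases "i = 0 \<or> i = 1")
    case False
    then obtain k where i: "i = Suc (Suc k)"
      by (metis One_nat_def not0_implies_Suc)
    define C where
      "C = {x \<otimes> y \<otimes> inv x \<otimes> inv y |x y. x \<in> carrier G \<and> y \<in> lower_central_series G (Suc k)}"
    have C: "C \<subseteq> carrier G"
      using G.lower_central_series_subset[of "Suc k"] by (auto simp: C_def)
    have "h ` C \<subseteq> {x \<otimes>\<^bsub>H\<^esub> y \<otimes>\<^bsub>H\<^esub> inv\<^bsub>H\<^esub> x \<otimes>\<^bsub>H\<^esub> inv\<^bsub>H\<^esub> y |x y.
        x \<in> carrier H \<and> y \<in> lower_central_series H (Suc k)}"
    proof
      fix z assume "z \<in> h ` C"
      then obtain x y where xy: "x \<in> carrier G" "y \<in> lower_central_series G (Suc k)"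
        and z: "z = h (x \<otimes> y \<otimes> inv x \<otimes> inv y)"
        by (auto simp: C_def)
      have y: "y \<in> carrier G" using xy G.lower_central_series_subset by blast
      have "z = h x \<otimes>\<^bsub>H\<^esub> h y \<otimes>\<^bsub>H\<^esub> inv\<^bsub>H\<^esub> (h x) \<otimes>\<^bsub>H\<^esub> inv\<^bsub>H\<^esub> (h y)"
        using xy y by (simp add: z)
      moreover have "h y \<in> lower_central_series H (Suc k)"
        using less[of "Suc k"] i xy by auto
      ultimately show "z \<in> {x \<otimes>\<^bsub>H\<^esub> y \<otimes>\<^bsub>H\<^esub> inv\<^bsub>H\<^esub> x \<otimes>\<^bsub>H\<^esub> inv\<^bsub>H\<^esub> y |x y.
          x \<in> carrier H \<and> y \<in> lower_central_series H (Suc k)}"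
        using hom_closed[OF xy(1)] by blast
    qed
    then show ?thesis
      using generate_img[OF C] mono_generate
      unfolding i lower_central_series.simps C_def[symmetric] by blast
  qed (auto simp: hom_closed)
qed

text \<open>On the coset \<open>N #> x\<close> the map \<open>h\<close> takes the single value
  \<open>h x\<close>, and \<open>\<one> \<in> N\<close> keeps the coset nonempty, so
  \<open>the_elem\<close> reads off this value. Multiplicativity holds because \<open>h\<close>
  turns a set product into the product of the values.\<close>

lemma (in group_hom) hom_factors_through_cosets:
  assumes N: "N \<subseteq> kernel G H h" "\<one> \<in> N"
  shows "\<exists>h'\<in>hom (G Mod N) H. \<forall>x\<in>carrier G. h x = h' (N #> x)"
proof -
  define h' where "h' = (\<lambda>C. the_elem (h ` C))"
  have coset: "h ` (N #> x) = {h x}" if "x \<in> carrier G" for x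
  proof -
    have "h (n \<otimes> x) = h x" if "n \<in> N" for n
      using that N \<open>x \<in> carrier G\<close> by (auto simp: kernel_def)
    then have "(\<lambda>n. h (n \<otimes> x)) ` N = {h x}"
      using N(2) by auto
    moreover have "N #> x = (\<lambda>n. n \<otimes> x) ` N"
      by (auto simp: r_coset_def)
    ultimately show ?thesis
      by (simp add: image_image)
  qed
  have "h' \<in> hom (G Mod N) H"
  proof (rule homI)
    show "h' C \<in> carrier H" if "C \<in> carrier (G Mod N)" for C
      using that coset by (auto simp: FactGroup_def RCOSETS_def h'_def)
    show "h' (C \<otimes>\<^bsub>G Mod N\<^esub> D) = h' C \<otimes>\<^bsub>H\<^esub> h' D"
      if CD: "C \<in> carrier (G Mod N)" "D \<in> carrier (G Mod N)" for C D
    proof -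
      obtain x y where xy: "x \<in> carrier G" "C = N #> x" "y \<in> carrier G" "D = N #> y"
        using CD by (auto simp: FactGroup_def RCOSETS_def)
      have sub: "C \<subseteq> carrier G" "D \<subseteq> carrier G"
        using xy N(1) by (auto simp: r_coset_def kernel_def)
      have "h ` C = {h x}" "h ` D = {h y}"
        using coset xy by auto
      moreover have "h ` (C <#> D) = {u \<otimes>\<^bsub>H\<^esub> v |u v. u \<in> h ` C \<and> v \<in> h ` D}"
      proof (intro equalityI subsetI)
        fix z assume "z \<in> h ` (C <#> D)"
        then obtain c d where "c \<in> C" "d \<in> D" "z = h (c \<otimes> d)"
          by (auto simp: set_mult_def)
        moreover have "h (c \<otimes> d) = h c \<otimes>\<^bsub>H\<^esub> h d"
          by (rule hom_mult[OF subsetD[OF sub(1) \<open>c \<in> C\<close>] subsetD[OF sub(2) \<open>d \<in> D\<close>]])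
        ultimately show "z \<in> {u \<otimes>\<^bsub>H\<^esub> v |u v. u \<in> h ` C \<and> v \<in> h ` D}" by blast
      next
        fix z assume "z \<in> {u \<otimes>\<^bsub>H\<^esub> v |u v. u \<in> h ` C \<and> v \<in> h ` D}"
        then obtain c d where cd: "c \<in> C" "d \<in> D" "z = h c \<otimes>\<^bsub>H\<^esub> h d" by blast
        have "z = h (c \<otimes> d)"
          unfolding cd(3) by (rule hom_mult[symmetric, OF subsetD[OF sub(1) cd(1)] subsetD[OF sub(2) cd(2)]])
        moreover have "c \<otimes> d \<in> C <#> D" using cd by (auto simp: set_mult_def)
        ultimately show "z \<in> h ` (C <#> D)" by blast
      qed
      ultimately show ?thesis
        by (simp add: h'_def FactGroup_def)
    qed
  qed
  moreover have "\<forall>x\<in>carrier G. h x = h' (N #> x)"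
    using coset by (simp add: h'_def)
  ultimately show ?thesis by blast
qed

section \<open>Words and presentations\<close>

lemma words_Nil [simp]: "[] \<in> words X"
  and words_Cons [simp]: "x # w \<in> words X \<longleftrightarrow> fst x \<in> X \<and> w \<in> words X"
  by (auto simp: words_def mem_Times_iff)

lemma has_presentation_relation:
  assumes "has_presentation G X R f" "(u, v) \<in> R" "u \<in> words X" "v \<in> words X"
  shows "word_value G f u = word_value G f v"
  using assms presentation_eq.relation[of u v R "[]" X "[]"]
  by (simp add: has_presentation_def)

text \<open>Membership in the carrier is carried through the induction because \<open>h\<close>
  respects products only there.\<close>

lemma (in group_hom) hom_word_value:
  assumes "f ` X \<subseteq> carrier G" "w \<in> words X"
  shows "h (word_value G f w) = word_value H (h \<circ> f) w \<and> word_value G f w \<in> carrier G"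
  using assms(2)
proof (induction w)
  case (Cons a w)
  obtain x e where a: "a = (x, e)" by (cases a)
  then have "f x \<in> carrier G" using Cons assms(1) by auto
  then show ?case using Cons a by simp
qed simp

lemma (in group) has_presentation_generate:
  assumes "has_presentation G X R f"
  shows "generate G (f ` X) = carrier G"
proof
  have fX: "f ` X \<subseteq> carrier G" using assms unfolding has_presentation_def by blast
  then show "generate G (f ` X) \<subseteq> carrier G" by (rule generate_incl)
  have "word_value G f w \<in> generate G (f ` X)" if "w \<in> words X" for w
    using that
  proof (induction w)
    case Nil
    show ?case by (simp add: generate.one)
  next
    case (Cons a w)
    obtain x e where a: "a = (x, e)" by (cases a)
    then have "f x \<in> f ` X" using Cons by auto
    then have "(if e then f x else inv f x) \<in> generate G (f ` X)"
      by (simp add: generate.incl generate.inv)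
    then show ?case using Cons a by (simp add: generate.eng)
  qed
  moreover have "carrier G = word_value G f ` words X"
    using assms unfolding has_presentation_def by blast
  ultimately show "carrier G \<subseteq> generate G (f ` X)" by auto
qed


section \<open>Centralisers in the symmetric group\<close>

text \<open>The iterates of \<open>x\<close> are distinct until the first return to
  \<open>x\<close>, and the return time \<open>N\<close> is the length of the cycle.\<close>

lemma funpow_eq_iff_mod_card_orbit:
  assumes "permutation s"
  shows "(s ^^ i) x = (s ^^ j) x \<longleftrightarrow> i mod card (orbit s x) = j mod card (orbit s x)"
proof -
  have self: "x \<in> orbit s x" using permutation_self_in_orbit[OF assms] .
  define N where "N = funpow_dist1 s x x"
  have inj: "inj_on (\<lambda>n. (s ^^ n) x) {0..<N}"
    unfolding N_def by (rule inj_on_funpow_dist1[OF self])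
  have "card (orbit s x) = N"
    using orbit_conv_funpow_dist1[OF self] card_image[OF inj] by (simp add: N_def)
  moreover have "(s ^^ N) x = x"
    unfolding N_def by (rule funpow_dist1_prop[OF self])
  then have "(s ^^ (n mod N)) x = (s ^^ n) x" for n
    by (rule funpow_mod_eq)
  moreover have "n mod N \<in> {0..<N}" for n
    by (simp add: N_def)
  ultimately show ?thesis
    using inj unfolding inj_on_def by metis
qed

text \<open>Every point of \<open>{1..m}\<close> is uniquely \<open>(s ^^ j) (r k i)\<close> with \<open>j\<close> taken modulo \<open>k\<close>;
  \<open>r k i\<close> is the base point of the \<open>i\<close>-th \<open>k\<close>-cycle.\<close>

locale cycle_coordinates =
  fixes m :: nat and s :: "nat \<Rightarrow> nat" and K :: "nat set" and l :: "nat \<Rightarrow> nat"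
    and r :: "nat \<Rightarrow> nat \<Rightarrow> nat"
  assumes s: "s permutes {1..m}"
    and pos: "k \<in> K \<Longrightarrow> 0 < k"
    and r_in: "\<lbrakk>k \<in> K; i \<in> {1..l k}\<rbrakk> \<Longrightarrow> r k i \<in> {1..m}"
    and r_surj: "x \<in> {1..m} \<Longrightarrow> \<exists>k\<in>K. \<exists>i\<in>{1..l k}. \<exists>j. x = (s ^^ j) (r k i)"
    and r_inj: "\<lbrakk>k \<in> K; i \<in> {1..l k}; k' \<in> K; i' \<in> {1..l k'}\<rbrakk> \<Longrightarrow>
      (s ^^ j) (r k i) = (s ^^ j') (r k' i') \<longleftrightarrow> k = k' \<and> i = i' \<and> j mod k = j' mod k"

text \<open>The set \<open>C k\<close> of \<open>k\<close>-cycles is numbered by \<open>e k\<close>,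
  and \<open>r\<close> picks a base point in each. A point is then given by the length and the
  number of its cycle and its distance from the base point.\<close>

lemma cycle_coordinates_exist:
  assumes s: "s permutes {1..m}"
  shows "\<exists>r. cycle_coordinates m s {k \<in> {1..m}. 0 < cycle_count m s k} (cycle_count m s) r"
proof -
  have perm: "permutation s" using s permutation_permutes finite_atLeastAtMost by metis
  have self: "x \<in> orbit s x" for x using permutation_self_in_orbit[OF perm] .
  have eq: "orbit s y = orbit s x" if "y \<in> orbit s x" for x y
    using orbit_cyclic_eq3[OF cyclic_on_orbit'[OF perm] that] .
  define C where "C = (\<lambda>k. {A. \<exists>x\<in>{1..m}. A = orbit s x \<and> card A = k})"
  define K where "K = {k \<in> {1..m}. 0 < cycle_count m s k}"
  have finC: "finite (C k)" for k
    by (rule finite_subset[of _ "orbit s ` {1..m}"]) (auto simp: C_def)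
  have count: "cycle_count m s k = card (C k)" for k
    by (simp add: cycle_count_def C_def)
  have "\<forall>k. \<exists>e. bij_betw e {1..card (C k)} (C k)"
    using ex_bij_betw_nat_finite_1[OF finC] by blast
  then obtain e where e: "bij_betw (e k) {1..cycle_count m s k} (C k)" for k
    unfolding count by metis
  define r where "r = (\<lambda>k i. SOME x. x \<in> {1..m} \<and> orbit s x = e k i)"
  have r: "r k i \<in> {1..m} \<and> orbit s (r k i) = e k i \<and> card (e k i) = k"
    if "i \<in> {1..cycle_count m s k}" for k i
  proof -
    have "e k i \<in> C k" using bij_betwE[OF e] that by blast
    then have "\<exists>x. x \<in> {1..m} \<and> orbit s x = e k i" "card (e k i) = k" by (auto simp: C_def)
    then show ?thesis unfolding r_def by (metis (mono_tags, lifting) someI_ex)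
  qed
  have "cycle_coordinates m s K (cycle_count m s) r"
  proof
    show "s permutes {1..m}" by fact
    show "0 < k" if "k \<in> K" for k using that by (simp add: K_def)
    show "r k i \<in> {1..m}" if "k \<in> K" "i \<in> {1..cycle_count m s k}" for k i
      using r that by blast
    show "\<exists>k\<in>K. \<exists>i\<in>{1..cycle_count m s k}. \<exists>j. x = (s ^^ j) (r k i)" if x: "x \<in> {1..m}" for x
    proof -
      define k where "k = card (orbit s x)"
      have sub: "orbit s x \<subseteq> {1..m}" by (rule permutes_orbit_subset[OF s x])
      have xC: "orbit s x \<in> C k" using x by (auto simp: C_def k_def)
      then obtain i where i: "i \<in> {1..cycle_count m s k}" "e k i = orbit s x"
        using e[of k] unfolding bij_betw_def by (metis imageE)
      have "x \<in> orbit s (r k i)" using r[OF i(1)] i(2) self by simp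
      then obtain j where "x = (s ^^ j) (r k i)"
        unfolding orbit_altdef_permutation[OF perm] by blast
      \<comment> \<open>The length of a cycle lies between 1 and \<open>m\<close>, and the count is
        positive because the cycle through \<open>x\<close> has a number \<open>i\<close>.\<close>
      moreover have "k \<in> K"
      proof -
        have "0 < card (orbit s x)" using finite_orbit[OF self] orbit_nonempty by (simp add: card_gt_0_iff)
        moreover have "card (orbit s x) \<le> m" using card_mono[OF _ sub] by simp
        ultimately show ?thesis using i(1) by (simp add: K_def k_def)
      qed
      ultimately show ?thesis using i(1) by blast
    qed
    show "(s ^^ j) (r k i) = (s ^^ j') (r k' i') \<longleftrightarrow> k = k' \<and> i = i' \<and> j mod k = j' mod k"
      if i: "i \<in> {1..cycle_count m s k}" and i': "i' \<in> {1..cycle_count m s k'}" for k i k' i' j j'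
    proof
      assume *: "(s ^^ j) (r k i) = (s ^^ j') (r k' i')"
      have "orbit s ((s ^^ n) x) = orbit s x" for n x
        by (rule eq) (use orbit_altdef_permutation[OF perm] in blast)
      then have "orbit s (r k i) = orbit s (r k' i')" using * by metis
      then have "e k i = e k' i'" using r i i' by metis
      then have k: "k = k'" using r i i' by metis
      have "i = i'"
        by (rule inj_onD[OF bij_betw_imp_inj_on[OF e[of k]]])
          (use i i' k \<open>e k i = e k' i'\<close> in simp_all)
      then have "(s ^^ j) (r k i) = (s ^^ j') (r k i)"
        using * k by blast
      then have "j mod k = j' mod k"
        unfolding funpow_eq_iff_mod_card_orbit[OF perm] using r[OF i] by metis
      then show "k = k' \<and> i = i' \<and> j mod k = j' mod k"
        using k \<open>i = i'\<close> by blast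
    next
      assume *: "k = k' \<and> i = i' \<and> j mod k = j' mod k"
      then have "(s ^^ j) (r k i) = (s ^^ j') (r k i)"
        unfolding funpow_eq_iff_mod_card_orbit[OF perm] using r[OF i] by metis
      then show "(s ^^ j) (r k i) = (s ^^ j') (r k' i')" using * by blast
    qed
  qed
  then show ?thesis unfolding K_def by blast
qed

section \<open>Wreath products acting on the cycles\<close>

context cycle_coordinates
begin

abbreviation wreaths :: "(nat \<Rightarrow> (nat \<Rightarrow> int) \<times> (nat \<Rightarrow> nat)) monoid" where
  "wreaths \<equiv> product_group K (\<lambda>k. wreath_product (integer_mod_group k) (l k))"

lemma wreaths_component:
  assumes "f \<in> carrier wreaths" "k \<in> K"
  shows "snd (f k) permutes {1..l k}" "i \<in> {1..l k} \<Longrightarrow> 0 \<le> fst (f k) i \<and> fst (f k) i < int k"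
    "i \<notin> {1..l k} \<Longrightarrow> fst (f k) i = undefined"
proof -
  have "f k \<in> carrier (wreath_product (integer_mod_group k) (l k))"
    using assms by (auto simp: product_group_def)
  then obtain x p where fk: "f k = (x, p)" "x \<in> (\<Pi>\<^sub>E i\<in>{1..l k}. carrier (integer_mod_group k))"
    "p permutes {1..l k}"
    by (auto simp: wreath_product_def)
  then show "snd (f k) permutes {1..l k}" by simp
  show "0 \<le> fst (f k) i \<and> fst (f k) i < int k" if "i \<in> {1..l k}"
    using PiE_mem[OF fk(2) that] pos[OF assms(2)] by (auto simp: fk carrier_integer_mod_group)
  show "fst (f k) i = undefined" if "i \<notin> {1..l k}"
    using PiE_arb[OF fk(2) that] by (simp add: fk)
qed

lemma s_pow_in: "x \<in> {1..m} \<Longrightarrow> (s ^^ j) x \<in> {1..m}"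
  using permutes_in_image[OF s] by (induction j) auto

text \<open>The position \<open>j\<close> is determined only modulo \<open>k\<close>, hence the
  choice; \<open>act_eq\<close> shows that the choice does not affect \<open>act\<close>.\<close>

definition coords :: "nat \<Rightarrow> nat \<times> nat \<times> nat" where
  "coords y = (SOME (k, i, j). k \<in> K \<and> i \<in> {1..l k} \<and> y = (s ^^ j) (r k i))"

text \<open>For \<open>f k = (x, p)\<close> the \<open>i\<close>-th \<open>k\<close>-cycle goes to
  the one with number \<open>p i\<close> and is rotated by \<open>x (p i)\<close>. The rotation is
  indexed by the target cycle to match the multiplication of \<open>wreath_product\<close>.\<close>

definition act :: "(nat \<Rightarrow> (nat \<Rightarrow> int) \<times> (nat \<Rightarrow> nat)) \<Rightarrow> nat \<Rightarrow> nat" where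
  "act f y = (if y \<in> {1..m} then
     (case coords y of (k, i, j) \<Rightarrow> (s ^^ (j + nat (fst (f k) (snd (f k) i)))) (r k (snd (f k) i)))
     else y)"

lemma coords:
  assumes "y \<in> {1..m}"
  obtains k i j where "coords y = (k, i, j)" "k \<in> K" "i \<in> {1..l k}" "y = (s ^^ j) (r k i)"
proof -
  have "\<exists>c. case c of (k, i, j) \<Rightarrow> k \<in> K \<and> i \<in> {1..l k} \<and> y = (s ^^ j) (r k i)"
    using r_surj[OF assms] by (simp add: Bex_def)
  from someI_ex[OF this] show ?thesis
    using that unfolding coords_def[symmetric] by (cases "coords y") auto
qed

lemma act_eq:
  assumes f: "f \<in> carrier wreaths" and k: "k \<in> K" and i: "i \<in> {1..l k}"
  shows "act f ((s ^^ j) (r k i)) = (s ^^ (j + nat (fst (f k) (snd (f k) i)))) (r k (snd (f k) i))"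
proof -
  define y where "y = (s ^^ j) (r k i)"
  have y: "y \<in> {1..m}" unfolding y_def by (intro s_pow_in r_in k i)
  obtain k' i' j' where c: "coords y = (k', i', j')" "k' \<in> K" "i' \<in> {1..l k'}" "y = (s ^^ j') (r k' i')"
    using coords[OF y] .
  have *: "k' = k" "i' = i" "j' mod k = j mod k"
    using r_inj[OF k i c(2,3), of j j'] c(4) y_def by auto
  define a where "a = nat (fst (f k) (snd (f k) i))"
  have pi: "snd (f k) i \<in> {1..l k}"
    using permutes_in_image[OF wreaths_component(1)[OF f k]] i by blast
  have "(j' + a) mod k = (j + a) mod k"
    using *(3) by (metis mod_add_left_eq)
  then have "(s ^^ (j' + a)) (r k (snd (f k) i)) = (s ^^ (j + a)) (r k (snd (f k) i))"
    using r_inj[OF k pi k pi] by blast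
  then show ?thesis
    using y c * unfolding act_def y_def[symmetric] a_def by simp
qed

text \<open>On each cycle \<open>s\<close> raises the position by 1, while \<open>act f\<close>
  shifts it by an amount depending only on the cycle, so the two commute. Bijectivity follows from
  injectivity on the finite set \<open>{1..m}\<close>.\<close>

lemma act_in_centraliser:
  assumes f: "f \<in> carrier wreaths"
  shows "act f \<in> centraliser (sym_group m) {s}"
proof -
  have inX: "act f y \<in> {1..m}" if y: "y \<in> {1..m}" for y
  proof -
    obtain k i j where c: "k \<in> K" "i \<in> {1..l k}" "y = (s ^^ j) (r k i)"
      using r_surj[OF y] by blast
    have "snd (f k) i \<in> {1..l k}"
      using permutes_in_image[OF wreaths_component(1)[OF f c(1)]] c by blast
    then show ?thesis unfolding c(3) act_eq[OF f c(1,2)] by (intro s_pow_in r_in c)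
  qed
  have "inj_on (act f) {1..m}"
  proof (rule inj_onI)
    fix y y' assume y: "y \<in> {1..m}" "y' \<in> {1..m}" and eq: "act f y = act f y'"
    obtain k i j where c: "k \<in> K" "i \<in> {1..l k}" "y = (s ^^ j) (r k i)"
      using r_surj[OF y(1)] by blast
    obtain k' i' j' where c': "k' \<in> K" "i' \<in> {1..l k'}" "y' = (s ^^ j') (r k' i')"
      using r_surj[OF y(2)] by blast
    have p: "snd (f k) i \<in> {1..l k}" "snd (f k') i' \<in> {1..l k'}"
      using permutes_in_image[OF wreaths_component(1)[OF f]] c c' by blast+
    define a where "a = nat (fst (f k) (snd (f k) i))"
    from eq have *: "k = k'" "snd (f k) i = snd (f k') i'"
      "(j + a) mod k = (j' + nat (fst (f k') (snd (f k') i'))) mod k"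
      unfolding c(3) c'(3) act_eq[OF f c(1,2)] act_eq[OF f c'(1,2)] a_def
      using r_inj[OF c(1) p(1) c'(1) p(2)] by auto
    then have "i = i'"
      using permutes_inj[OF wreaths_component(1)[OF f c(1)]] by (auto simp: inj_def)
    moreover have "(j + a) mod k = (j' + a) mod k"
      using * by (simp add: a_def)
    then have "j mod k = j' mod k"
      by (auto simp: nat_mod_eq_iff)
    ultimately show "y = y'"
      unfolding c(3) c'(3) using r_inj[OF c(1,2) c'(1,2)] *(1) by blast
  qed
  moreover have "act f ` {1..m} \<subseteq> {1..m}" using inX by blast
  ultimately have "bij_betw (act f) {1..m} {1..m}"
    by (simp add: bij_betw_def endo_inj_surj)
  then have perm: "act f permutes {1..m}"
    by (rule bij_imp_permutes) (simp only: act_def if_False)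
  have "act f (s y) = s (act f y)" for y
  proof (cases "y \<in> {1..m}")
    case True
    obtain k i j where c: "k \<in> K" "i \<in> {1..l k}" "y = (s ^^ j) (r k i)"
      using r_surj[OF True] by blast
    have "s y = (s ^^ Suc j) (r k i)" using c by simp
    then show ?thesis
      using act_eq[OF f c(1,2), of "Suc j"] act_eq[OF f c(1,2), of j] c(3) by simp
  next
    case False
    then show ?thesis
      using permutes_not_in[OF s] permutes_not_in[OF perm] by simp
  qed
  then show ?thesis
    using perm by (auto simp: centraliser_def sym_group_def)
qed

text \<open>A point of cycle \<open>i\<close> is rotated by \<open>h\<close> on arriving in
  \<open>q i\<close> and by \<open>f\<close> on arriving in \<open>p (q i)\<close>. The sum is the
  entry of the product at \<open>p (q i)\<close>, and reducing it modulo \<open>k\<close> does not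
  change the point.\<close>

lemma act_mult:
  assumes f: "f \<in> carrier wreaths" and h: "h \<in> carrier wreaths"
    and fh: "f \<otimes>\<^bsub>wreaths\<^esub> h \<in> carrier wreaths"
  shows "act (f \<otimes>\<^bsub>wreaths\<^esub> h) = act f \<circ> act h"
proof
  fix y
  show "act (f \<otimes>\<^bsub>wreaths\<^esub> h) y = (act f \<circ> act h) y"
  proof (cases "y \<in> {1..m}")
    case True
    obtain k i j where c: "k \<in> K" "i \<in> {1..l k}" "y = (s ^^ j) (r k i)"
      using r_surj[OF True] by blast
    define p q where "p = snd (f k)" and "q = snd (h k)"
    have p: "p permutes {1..l k}" and q: "q permutes {1..l k}"
      using wreaths_component(1)[OF f c(1)] wreaths_component(1)[OF h c(1)] by (auto simp: p_def q_def)
    have qi: "q i \<in> {1..l k}" and pqi: "p (q i) \<in> {1..l k}"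
      using permutes_in_image[OF p] permutes_in_image[OF q] c by blast+
    define a b where "a = fst (f k) (p (q i))" and "b = fst (h k) (q i)"
    have ab: "0 \<le> a" "0 \<le> b"
      using wreaths_component(2)[OF f c(1) pqi] wreaths_component(2)[OF h c(1) qi]
      by (auto simp: a_def b_def)
    have fhk: "(f \<otimes>\<^bsub>wreaths\<^esub> h) k =
        (\<lambda>i\<in>{1..l k}. (fst (f k) i + fst (h k) (inv_into UNIV p i)) mod int k, p \<circ> q)"
      using c(1) by (simp add: product_group_def wreath_product_def case_prod_unfold p_def q_def)
    have "act (f \<otimes>\<^bsub>wreaths\<^esub> h) y = (s ^^ (j + nat ((a + b) mod int k))) (r k (p (q i)))"
      unfolding c(3) act_eq[OF fh c(1,2)] fhk using pqi
      by (simp add: a_def b_def inv_f_f[OF permutes_inj[OF p]])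
    also have "\<dots> = (s ^^ (j + nat b + nat a)) (r k (p (q i)))"
    proof -
      have "nat ((a + b) mod int k) = (nat a + nat b) mod k"
        using ab by (simp add: nat_mod_distrib nat_add_distrib)
      then have "(j + nat ((a + b) mod int k)) mod k = (j + nat b + nat a) mod k"
        by (simp add: mod_add_right_eq ac_simps)
      then show ?thesis using r_inj[OF c(1) pqi c(1) pqi] by blast
    qed
    also have "\<dots> = act f (act h y)"
      unfolding c(3) act_eq[OF h c(1,2)]
      using act_eq[OF f c(1) qi, of "j + nat b"] by (simp add: a_def b_def p_def q_def)
    finally show ?thesis by simp
  next
    case False
    then show ?thesis by (simp only: act_def comp_apply if_False)
  qed
qed

lemma wreath_mult_closed:
  assumes "f \<in> carrier wreaths" "h \<in> carrier wreaths"
  shows "f \<otimes>\<^bsub>wreaths\<^esub> h \<in> carrier wreaths"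
proof -
  have "(f \<otimes>\<^bsub>wreaths\<^esub> h) k \<in> carrier (wreath_product (integer_mod_group k) (l k))" if k: "k \<in> K" for k
    using k pos[OF k] permutes_compose[OF wreaths_component(1)[OF assms(2) k] wreaths_component(1)[OF assms(1) k]]
    by (auto simp: product_group_def wreath_product_def case_prod_unfold carrier_integer_mod_group)
  then show ?thesis
    by (auto simp: product_group_def)
qed

text \<open>Evaluation at the base points recovers the permutations and the rotations, the latter
  being residues below \<open>k\<close>. Off the index ranges both elements take the same default
  values.\<close>

lemma act_inj: "inj_on act (carrier wreaths)"
proof (rule inj_onI)
  fix f h assume f: "f \<in> carrier wreaths" and h: "h \<in> carrier wreaths" and eq: "act f = act h"
  have *: "snd (f k) i = snd (h k) i \<and> fst (f k) (snd (f k) i) = fst (h k) (snd (f k) i)"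
    if k: "k \<in> K" and i: "i \<in> {1..l k}" for k i
  proof -
    have p: "snd (f k) i \<in> {1..l k}" "snd (h k) i \<in> {1..l k}"
      using permutes_in_image wreaths_component(1)[OF f k] wreaths_component(1)[OF h k] i by metis+
    have "act f ((s ^^ 0) (r k i)) = act h ((s ^^ 0) (r k i))" using eq by simp
    then have "snd (f k) i = snd (h k) i"
      "nat (fst (f k) (snd (f k) i)) mod k = nat (fst (h k) (snd (h k) i)) mod k"
      unfolding act_eq[OF f k i] act_eq[OF h k i] using r_inj[OF k p(1) k p(2)] by auto
    then show ?thesis
      using wreaths_component(2)[OF f k p(1)] wreaths_component(2)[OF h k p(2)]
      by (metis eq_nat_nat_iff mod_less nat_less_iff)
  qed
  have "f k = h k" if k: "k \<in> K" for k
  proof (rule prod_eqI)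
    note p = wreaths_component(1)[OF f k] wreaths_component(1)[OF h k]
    show "snd (f k) = snd (h k)"
    proof
      fix i show "snd (f k) i = snd (h k) i"
        by (cases "i \<in> {1..l k}") (use * k p permutes_not_in in metis)+
    qed
    show "fst (f k) = fst (h k)"
    proof
      fix i
      show "fst (f k) i = fst (h k) i"
      proof (cases "i \<in> {1..l k}")
        case True
        then obtain i' where i': "i' \<in> {1..l k}" "i = snd (f k) i'"
          using permutes_image[OF p(1)] by (metis imageE)
        show ?thesis unfolding i'(2) using *[OF k i'(1)] by blast
      next
        case False
        then show ?thesis
          using wreaths_component(3)[OF f k] wreaths_component(3)[OF h k] by simp
      qed
    qed
  qed
  moreover have "f k = h k" if "k \<notin> K" for k
    using that f h by (auto simp: product_group_def PiE_def extensional_def)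
  ultimately show "f = h" by blast
qed

text \<open>A permutation commuting with \<open>s\<close> is determined by its values at the base
  points. These give the number \<open>p k i\<close> of the target cycle and the rotation
  \<open>d k i\<close>.\<close>

lemma act_surj:
  assumes c: "c \<in> centraliser (sym_group m) {s}"
  shows "\<exists>f\<in>carrier wreaths. act f = c"
proof -
  have perm: "c permutes {1..m}" and comm: "c \<circ> s = s \<circ> c"
    using c by (auto simp: centraliser_def sym_group_def)
  have cpow: "c ((s ^^ j) y) = (s ^^ j) (c y)" for j y
  proof (induction j)
    case (Suc j)
    then show ?case using fun_cong[OF comm] by simp
  qed simp
  have inj: "c x = c y \<Longrightarrow> x = y" for x y
    using permutes_inj[OF perm] by (simp add: inj_eq)
  have "\<exists>i' d. i' \<in> {1..l k} \<and> c (r k i) = (s ^^ d) (r k i')" if k: "k \<in> K" and i: "i \<in> {1..l k}" for k i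
  proof -
    have "c (r k i) \<in> {1..m}"
      using permutes_in_image[OF perm] r_in[OF k i] by blast
    then obtain k' i' d where *: "k' \<in> K" "i' \<in> {1..l k'}" "c (r k i) = (s ^^ d) (r k' i')"
      using r_surj by blast
    \<comment> \<open>The period of \<open>c (r k i)\<close> under \<open>s\<close> is
      \<open>k'\<close> when computed in the target cycle and \<open>k\<close> when pulled back
      through \<open>c\<close>, so the two cycles have equal length.\<close>
    have per: "(s ^^ n) (c (r k i)) = c (r k i) \<longleftrightarrow> k' dvd n" for n
    proof -
      have "(s ^^ n) (c (r k i)) = c (r k i) \<longleftrightarrow> (s ^^ (n + d)) (r k' i') = (s ^^ d) (r k' i')"
        by (simp add: * funpow_add)
      also have "\<dots> \<longleftrightarrow> (n + d) mod k' = d mod k'"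
        using r_inj[OF *(1,2,1,2)] by blast
      also have "\<dots> \<longleftrightarrow> k' dvd n"
        by (simp add: mod_eq_dvd_iff_nat)
      finally show ?thesis .
    qed
    have per': "(s ^^ n) (c (r k i)) = c (r k i) \<longleftrightarrow> k dvd n" for n
    proof -
      have "(s ^^ n) (c (r k i)) = c (r k i) \<longleftrightarrow> c ((s ^^ n) (r k i)) = c ((s ^^ 0) (r k i))"
        by (simp add: cpow)
      also have "\<dots> \<longleftrightarrow> (s ^^ n) (r k i) = (s ^^ 0) (r k i)"
        by (rule inj_eq[OF permutes_inj[OF perm]])
      also have "\<dots> \<longleftrightarrow> n mod k = 0 mod k"
        using r_inj[OF k i k i, of n 0] by blast
      also have "\<dots> \<longleftrightarrow> k dvd n"
        by (simp add: dvd_eq_mod_eq_0)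
      finally show ?thesis .
    qed
    have d: "k' dvd k" "k dvd k'" using per[of k] per'[of k] per[of k'] per'[of k'] by auto
    have "k = k'" by (rule dvd_antisym[OF d(2,1)])
    then show ?thesis using * by blast
  qed
  then obtain p d where p: "p k i \<in> {1..l k}" and cr: "c (r k i) = (s ^^ d k i) (r k (p k i))"
    if "k \<in> K" "i \<in> {1..l k}" for k i
    by metis
  have p_inj: "inj_on (p k) {1..l k}" if k: "k \<in> K" for k
  proof (rule inj_onI)
    fix i i' assume i: "i \<in> {1..l k}" "i' \<in> {1..l k}" and eq: "p k i = p k i'"
    \<comment> \<open>If two cycles had the same target, shifting each base point by the rotation of
      the other cycle would give points with equal image under \<open>c\<close>.\<close>
    have "c ((s ^^ d k i') (r k i)) = (s ^^ (d k i' + d k i)) (r k (p k i))"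
      by (simp only: cpow cr[OF k i(1)] funpow_add comp_apply)
    also have "\<dots> = (s ^^ (d k i + d k i')) (r k (p k i'))"
      by (simp only: eq add.commute)
    also have "\<dots> = c ((s ^^ d k i) (r k i'))"
      by (simp only: cpow cr[OF k i(2)] funpow_add comp_apply)
    finally have "(s ^^ d k i') (r k i) = (s ^^ d k i) (r k i')" by (rule inj)
    then show "i = i'" using r_inj[OF k i(1) k i(2)] by blast
  qed
  define P where "P = (\<lambda>k i. if i \<in> {1..l k} then p k i else i)"
  have P: "P k permutes {1..l k}" if k: "k \<in> K" for k
  proof (rule bij_imp_permutes)
    have "p k ` {1..l k} \<subseteq> {1..l k}" using p[OF k] by blast
    then have "bij_betw (p k) {1..l k} {1..l k}"
      using p_inj[OF k] by (simp add: bij_betw_def endo_inj_surj)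
    then show "bij_betw (P k) {1..l k} {1..l k}"
      using bij_betw_cong[of "{1..l k}" "P k" "p k"] by (simp add: P_def)
    show "P k i = i" if "i \<notin> {1..l k}" for i
      using that unfolding P_def by (simp only: if_False)
  qed
  \<comment> \<open>\<open>d\<close> is indexed by the source cycle but the wreath product by the
    target, hence the inverse of \<open>P k\<close>. Reduction modulo \<open>k\<close> lands in the
    carrier of \<open>integer_mod_group k\<close>.\<close>
  define f where "f = (\<lambda>k\<in>K. (\<lambda>i\<in>{1..l k}. int (d k (inv_into UNIV (P k) i) mod k), P k))"
  have f: "f \<in> carrier wreaths"
    using P pos by (auto simp: f_def product_group_def wreath_product_def carrier_integer_mod_group)
  have "act f y = c y" for y
  proof (cases "y \<in> {1..m}")
    case True
    obtain k i j where y: "k \<in> K" "i \<in> {1..l k}" "y = (s ^^ j) (r k i)"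
      using r_surj[OF True] by blast
    have fk: "snd (f k) i = p k i" "fst (f k) (p k i) = int (d k i mod k)"
    proof -
      show "snd (f k) i = p k i" using y by (simp add: f_def P_def)
      have "inv_into UNIV (P k) (p k i) = i"
        using inv_f_f[OF permutes_inj[OF P[OF y(1)]], of i] y(2) by (simp add: P_def)
      then show "fst (f k) (p k i) = int (d k i mod k)"
        using y p[OF y(1,2)] by (simp add: f_def)
    qed
    have "act f y = (s ^^ (j + d k i mod k)) (r k (p k i))"
      unfolding y(3) act_eq[OF f y(1,2)] fk by simp
    also have "\<dots> = (s ^^ (j + d k i)) (r k (p k i))"
      using r_inj[OF y(1) p[OF y(1,2)] y(1) p[OF y(1,2)]] by (simp add: mod_add_right_eq)
    also have "\<dots> = (s ^^ j) (c (r k i))"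
      by (simp only: cr[OF y(1,2)] funpow_add comp_apply)
    also have "\<dots> = c y" by (simp add: y cpow)
    finally show ?thesis .
  next
    case False
    then show ?thesis
      using permutes_not_in[OF perm False] by (simp only: act_def if_False)
  qed
  then have "act f = c" by (rule ext)
  then show ?thesis using f by blast
qed

text \<open>\<open>act\<close> runs from the wreath products to the centraliser; the isomorphism is
  its inverse, multiplicative because \<open>act\<close> is multiplicative and injective.\<close>

lemma centraliser_iso_wreaths:
  "(sym_group m)\<lparr>carrier := centraliser (sym_group m) {s}\<rparr> \<cong> wreaths"
proof -
  define Z where "Z = (sym_group m)\<lparr>carrier := centraliser (sym_group m) {s}\<rparr>"
  define act' where "act' = inv_into (carrier wreaths) act"
  have bij: "bij_betw act (carrier wreaths) (carrier Z)"
    unfolding bij_betw_def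
  proof (intro conjI equalityI subsetI)
    show "c \<in> carrier Z" if "c \<in> act ` carrier wreaths" for c
      using that act_in_centraliser by (auto simp: Z_def)
    show "c \<in> act ` carrier wreaths" if "c \<in> carrier Z" for c
    proof -
      have "c \<in> centraliser (sym_group m) {s}" using that by (simp add: Z_def)
      then obtain f where "f \<in> carrier wreaths" "act f = c" using act_surj by blast
      then show ?thesis by (intro image_eqI[of c act f]) simp_all
    qed
  qed (rule act_inj)
  have act': "act' c \<in> carrier wreaths \<and> act (act' c) = c" if "c \<in> carrier Z" for c
    unfolding act'_def
  proof
    show "inv_into (carrier wreaths) act c \<in> carrier wreaths"
      by (rule bij_betw_apply[OF bij_betw_inv_into[OF bij] that])
    show "act (inv_into (carrier wreaths) act c) = c"
      by (rule bij_betw_inv_into_right[OF bij that])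
  qed
  have "act' \<in> hom Z wreaths"
  proof (rule homI)
    show "act' c \<in> carrier wreaths" if "c \<in> carrier Z" for c
      using act' that by blast
    show "act' (c \<otimes>\<^bsub>Z\<^esub> d) = act' c \<otimes>\<^bsub>wreaths\<^esub> act' d"
      if "c \<in> carrier Z" "d \<in> carrier Z" for c d
    proof -
      have closed: "act' c \<otimes>\<^bsub>wreaths\<^esub> act' d \<in> carrier wreaths"
        using act' that wreath_mult_closed by blast
      have "act (act' c \<otimes>\<^bsub>wreaths\<^esub> act' d) = act (act' c) \<circ> act (act' d)"
        using act' that closed by (intro act_mult) auto
      also have "\<dots> = c \<otimes>\<^bsub>Z\<^esub> d"
        using act' that by (simp add: Z_def sym_group_def)
      finally have "act' (c \<otimes>\<^bsub>Z\<^esub> d) = act' (act (act' c \<otimes>\<^bsub>wreaths\<^esub> act' d))"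
        by simp
      also have "\<dots> = act' c \<otimes>\<^bsub>wreaths\<^esub> act' d"
        unfolding act'_def by (rule inv_into_f_f[OF act_inj closed[unfolded act'_def]])
      finally show ?thesis .
    qed
  qed
  moreover have "bij_betw act' (carrier Z) (carrier wreaths)"
    unfolding act'_def by (rule bij_betw_inv_into[OF bij])
  ultimately show ?thesis
    unfolding is_iso_def iso_def Z_def by blast
qed

end


section \<open>Homomorphisms with equal values on the \<open>\<sigma>\<^sub>i\<close>\<close>

lemma (in group_hom) hom_relation:
  assumes "has_presentation G X R f" "(u, v) \<in> R" "u \<in> words X" "v \<in> words X"
  shows "word_value H (h \<circ> f) u = word_value H (h \<circ> f) v"
proof -
  have "f ` X \<subseteq> carrier G" using assms(1) unfolding has_presentation_def by blast
  then show ?thesis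
    using has_presentation_relation[OF assms] hom_word_value assms(3,4) by metis
qed

text \<open>Moving every \<open>s\<close> to the left turns the last hypothesis into
  \<open>s (a b) = s (s s (b a))\<close>, and one \<open>s\<close> cancels.\<close>

lemma (in group) eq_square_mult_commuted:
  assumes "a \<in> carrier G" "b \<in> carrier G" "s \<in> carrier G"
    and as: "a \<otimes> s = s \<otimes> a" and bs: "b \<otimes> s = s \<otimes> b"
    and eq: "a \<otimes> (s \<otimes> b) = s \<otimes> (b \<otimes> (s \<otimes> (a \<otimes> s)))"
  shows "a \<otimes> b = s \<otimes> s \<otimes> (b \<otimes> a)"
proof -
  have "b \<otimes> s \<otimes> (a \<otimes> s) = s \<otimes> b \<otimes> (s \<otimes> a)"
    by (simp only: as bs)
  also have "\<dots> = s \<otimes> (b \<otimes> s) \<otimes> a"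
    using assms(1-3) by (simp add: m_assoc)
  also have "\<dots> = s \<otimes> (s \<otimes> b) \<otimes> a"
    by (simp only: bs)
  also have "\<dots> = s \<otimes> s \<otimes> (b \<otimes> a)"
    using assms(1-3) by (simp add: m_assoc)
  finally have bsas: "b \<otimes> s \<otimes> (a \<otimes> s) = s \<otimes> s \<otimes> (b \<otimes> a)" .
  have "s \<otimes> (a \<otimes> b) = a \<otimes> s \<otimes> b"
    unfolding as using assms(1-3) by (simp add: m_assoc)
  also have "\<dots> = s \<otimes> (b \<otimes> s \<otimes> (a \<otimes> s))"
    using eq assms(1-3) by (simp add: m_assoc)
  finally show ?thesis
    unfolding bsas using assms(1-3) by simp
qed

text \<open>By \<open>onto\<close>, \<open>H\<close> is the image group, so an element is central in
  \<open>H\<close> once it commutes with the images of the generators. The bound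
  \<open>3 \<le> n\<close> provides a second braid generator \<open>\<sigma> 2\<close>.\<close>

locale surface_braid_hom = group_hom G H h
  for G (structure) and H (structure) and h +
  fixes g n :: nat and a b \<sigma> :: "nat \<Rightarrow> 'a"
  assumes n: "3 \<le> n"
    and presentation: "has_presentation G (surface_braid_generators g n) (surface_braid_relations g n)
      (case_braid_generator a b \<sigma>)"
    and onto: "h ` carrier G = carrier H"
    and all_eq: "i \<in> {1..<n} \<Longrightarrow> h (\<sigma> i) = h (\<sigma> 1)"
begin

abbreviation gens where "gens \<equiv> surface_braid_generators g n"
abbreviation \<phi> where "\<phi> \<equiv> h \<circ> case_braid_generator a b \<sigma>"

lemma gens_simps [simp]:
  "Gen_a i \<in> gens \<longleftrightarrow> i \<in> {1..g}" "Gen_b i \<in> gens \<longleftrightarrow> i \<in> {1..g}" "Gen_s i \<in> gens \<longleftrightarrow> i \<in> {1..<n}"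
  by (auto simp: surface_braid_generators_def)

lemma gen_closed: "x \<in> gens \<Longrightarrow> case_braid_generator a b \<sigma> x \<in> carrier G"
  using presentation unfolding has_presentation_def by blast

lemma \<phi>_closed: "x \<in> gens \<Longrightarrow> \<phi> x \<in> carrier H"
  using gen_closed by simp

lemma generate_\<phi>: "generate H (\<phi> ` gens) = carrier H"
proof -
  have "generate H (h ` case_braid_generator a b \<sigma> ` gens) = h ` generate G (case_braid_generator a b \<sigma> ` gens)"
    by (rule generate_img) (use gen_closed in auto)
  then show ?thesis
    using G.has_presentation_generate[OF presentation] onto by (simp add: image_comp)
qed

lemma relation:
  assumes "(u, v) \<in> surface_braid_relations g n" "u \<in> words gens" "v \<in> words gens"
  shows "word_value H \<phi> u = word_value H \<phi> v"
  by (rule hom_relation[OF presentation assms])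

lemma \<phi>_s: "i \<in> {1..<n} \<Longrightarrow> \<phi> (Gen_s i) = h (\<sigma> 1)"
  using all_eq[of i] by simp

lemma s_closed: "h (\<sigma> 1) \<in> carrier H"
  using \<phi>_closed[of "Gen_s 1"] n by simp

text \<open>Every \<open>a\<^sub>i\<close> and \<open>b\<^sub>i\<close> commutes with \<open>\<sigma>\<^sub>2\<close>, whose image is that of \<open>\<sigma>\<^sub>1\<close>.\<close>

lemma c_commutes_s:
  assumes "i \<in> {1..g}" "c \<in> {Gen_a i, Gen_b i}"
  shows "\<phi> c \<otimes>\<^bsub>H\<^esub> h (\<sigma> 1) = h (\<sigma> 1) \<otimes>\<^bsub>H\<^esub> \<phi> c"
proof -
  have c: "c \<in> gens" using assms by auto
  have "word_value H \<phi> [pos c, pos (Gen_s 2)] = word_value H \<phi> [pos (Gen_s 2), pos c]"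
    by (rule relation[OF surface_braid_relations.c_s_far[OF assms]]) (use c n in \<open>auto simp: pos_def\<close>)
  then have "\<phi> c \<otimes>\<^bsub>H\<^esub> \<phi> (Gen_s 2) = \<phi> (Gen_s 2) \<otimes>\<^bsub>H\<^esub> \<phi> c"
    using \<phi>_closed[OF c] \<phi>_closed[of "Gen_s 2"] n by (simp add: pos_def del: comp_apply)
  then show ?thesis using \<phi>_s[of 2] n by (simp del: comp_apply)
qed

lemma gens_cases:
  assumes "x \<in> gens"
  obtains (c) i where "i \<in> {1..g}" "x \<in> {Gen_a i, Gen_b i}"
  | (s) i where "i \<in> {1..<n}" "x = Gen_s i"
  using assms unfolding surface_braid_generators_def by blast

lemma s_central: "h (\<sigma> 1) \<in> centraliser H (carrier H)"
proof -
  have "h (\<sigma> 1) \<in> centraliser H (\<phi> ` gens)"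
  proof (rule centraliserI)
    fix y assume "y \<in> \<phi> ` gens"
    then obtain x where x: "x \<in> gens" "y = \<phi> x" by blast
    from x(1) show "h (\<sigma> 1) \<otimes>\<^bsub>H\<^esub> y = y \<otimes>\<^bsub>H\<^esub> h (\<sigma> 1)"
    proof (cases rule: gens_cases)
      case (c i)
      then show ?thesis using c_commutes_s[OF c] x(2) by simp
    next
      case (s i)
      then show ?thesis using \<phi>_s[of i] x(2) by simp
    qed
  qed (rule s_closed)
  then show ?thesis
    using H.centraliser_generate[of "\<phi> ` gens"] \<phi>_closed generate_\<phi> by (simp add: image_subset_iff)
qed

text \<open>Since \<open>s\<close> commutes with the image of \<open>d\<close>, conjugation by
  \<open>s\<close> in the relation has no effect on it.\<close>

lemma c_d_commute:
  assumes ij: "1 \<le> j" "j < i" "i \<le> g" and c: "c \<in> {Gen_a i, Gen_b i}" and d: "d \<in> {Gen_a j, Gen_b j}"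
  shows "\<phi> c \<otimes>\<^bsub>H\<^esub> \<phi> d = \<phi> d \<otimes>\<^bsub>H\<^esub> \<phi> c"
proof -
  have cg: "c \<in> gens" and dg: "d \<in> gens" using assms by auto
  define s where "s = h (\<sigma> 1)"
  have s1: "\<phi> (Gen_s 1) = s" by (simp add: s_def)
  note closed = \<phi>_closed[OF cg] \<phi>_closed[OF dg] s_closed[folded s_def]
  have comm: "\<phi> d \<otimes>\<^bsub>H\<^esub> s = s \<otimes>\<^bsub>H\<^esub> \<phi> d"
    unfolding s_def by (rule c_commutes_s[of j]) (use assms in auto)
  have "word_value H \<phi> [pos c, neg (Gen_s 1), pos d, pos (Gen_s 1)] =
      word_value H \<phi> [neg (Gen_s 1), pos d, pos (Gen_s 1), pos c]"
    by (rule relation[OF surface_braid_relations.c_d[OF ij c d]])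
      (use cg dg n in \<open>auto simp: pos_def neg_def\<close>)
  then have "\<phi> c \<otimes>\<^bsub>H\<^esub> (inv\<^bsub>H\<^esub> s \<otimes>\<^bsub>H\<^esub> (\<phi> d \<otimes>\<^bsub>H\<^esub> s)) = inv\<^bsub>H\<^esub> s \<otimes>\<^bsub>H\<^esub> (\<phi> d \<otimes>\<^bsub>H\<^esub> s) \<otimes>\<^bsub>H\<^esub> \<phi> c"
    using closed by (simp add: pos_def neg_def s1 H.m_assoc del: comp_apply One_nat_def)
  moreover have "inv\<^bsub>H\<^esub> s \<otimes>\<^bsub>H\<^esub> (\<phi> d \<otimes>\<^bsub>H\<^esub> s) = \<phi> d"
    unfolding comm using closed by (simp add: H.m_assoc[symmetric] del: comp_apply)
  ultimately show ?thesis by metis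
qed

lemma a_b_commute:
  assumes i: "i \<in> {1..g}"
  shows "\<phi> (Gen_a i) \<otimes>\<^bsub>H\<^esub> \<phi> (Gen_b i) = h (\<sigma> 1) \<otimes>\<^bsub>H\<^esub> h (\<sigma> 1) \<otimes>\<^bsub>H\<^esub> (\<phi> (Gen_b i) \<otimes>\<^bsub>H\<^esub> \<phi> (Gen_a i))"
proof (rule H.eq_square_mult_commuted)
  have ab: "Gen_a i \<in> gens" "Gen_b i \<in> gens" "Gen_s 1 \<in> gens" using i n by auto
  show closed: "\<phi> (Gen_a i) \<in> carrier H" "\<phi> (Gen_b i) \<in> carrier H" "h (\<sigma> 1) \<in> carrier H"
    using \<phi>_closed ab s_closed by blast+
  show "\<phi> (Gen_a i) \<otimes>\<^bsub>H\<^esub> h (\<sigma> 1) = h (\<sigma> 1) \<otimes>\<^bsub>H\<^esub> \<phi> (Gen_a i)"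
    "\<phi> (Gen_b i) \<otimes>\<^bsub>H\<^esub> h (\<sigma> 1) = h (\<sigma> 1) \<otimes>\<^bsub>H\<^esub> \<phi> (Gen_b i)"
    using c_commutes_s[OF i] by blast+
  have s1: "\<phi> (Gen_s 1) = h (\<sigma> 1)" by simp
  have "word_value H \<phi> [pos (Gen_a i), pos (Gen_s 1), pos (Gen_b i)] =
      word_value H \<phi> [pos (Gen_s 1), pos (Gen_b i), pos (Gen_s 1), pos (Gen_a i), pos (Gen_s 1)]"
    by (rule relation[OF surface_braid_relations.a_b[OF i]]) (use i n in \<open>auto simp: pos_def\<close>)
  then show "\<phi> (Gen_a i) \<otimes>\<^bsub>H\<^esub> (h (\<sigma> 1) \<otimes>\<^bsub>H\<^esub> \<phi> (Gen_b i)) = h (\<sigma> 1) \<otimes>\<^bsub>H\<^esub>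
      (\<phi> (Gen_b i) \<otimes>\<^bsub>H\<^esub> (h (\<sigma> 1) \<otimes>\<^bsub>H\<^esub> (\<phi> (Gen_a i) \<otimes>\<^bsub>H\<^esub> h (\<sigma> 1))))"
    using closed by (simp add: pos_def s1 del: comp_apply One_nat_def)
qed

text \<open>All pairs commute except possibly \<open>Gen_a i\<close> and \<open>Gen_b i\<close>,
  where the central factor is the square of \<open>h (\<sigma> 1)\<close> or, in the opposite order,
  its inverse.\<close>

lemma gens_commute_modulo_centre:
  assumes "x \<in> gens" "y \<in> gens"
  shows "\<exists>z\<in>centraliser H (carrier H). \<phi> x \<otimes>\<^bsub>H\<^esub> \<phi> y = z \<otimes>\<^bsub>H\<^esub> (\<phi> y \<otimes>\<^bsub>H\<^esub> \<phi> x)"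
proof -
  interpret Z: subgroup "centraliser H (carrier H)" H
    by (rule H.subgroup_centraliser) simp
  note closed = \<phi>_closed[OF assms(1)] \<phi>_closed[OF assms(2)]
  have commI: ?thesis if "\<phi> x \<otimes>\<^bsub>H\<^esub> \<phi> y = \<phi> y \<otimes>\<^bsub>H\<^esub> \<phi> x"
    using that closed Z.one_closed by (intro bexI[of _ "\<one>\<^bsub>H\<^esub>"]) (simp_all del: comp_apply)
  have sc: "\<phi> u \<otimes>\<^bsub>H\<^esub> h (\<sigma> 1) = h (\<sigma> 1) \<otimes>\<^bsub>H\<^esub> \<phi> u" if "u \<in> gens" for u
    by (rule centraliserD[OF s_central \<phi>_closed[OF that], symmetric])
  have z: "h (\<sigma> 1) \<otimes>\<^bsub>H\<^esub> h (\<sigma> 1) \<in> centraliser H (carrier H)"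
    using s_central by simp
  from assms(1) show ?thesis
  proof (cases rule: gens_cases)
    case (s i)
    then have "\<phi> x = h (\<sigma> 1)" using \<phi>_s[of i] by simp
    then show ?thesis using sc[OF assms(2)] by (intro commI) metis
  next
    case x: (c i)
    from assms(2) show ?thesis
    proof (cases rule: gens_cases)
      case (s j)
      then have "\<phi> y = h (\<sigma> 1)" using \<phi>_s[of j] by simp
      then show ?thesis using sc[OF assms(1)] by (intro commI) metis
    next
      case y: (c j)
      consider "i < j" | "j < i" | "i = j" "x = y" | "x = Gen_a i" "y = Gen_b i" | "x = Gen_b i" "y = Gen_a i"
        using x y by fastforce
      then show ?thesis
      proof cases
        case 1
        have "\<phi> y \<otimes>\<^bsub>H\<^esub> \<phi> x = \<phi> x \<otimes>\<^bsub>H\<^esub> \<phi> y"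
          by (rule c_d_commute[of i j]) (use 1 x y in auto)
        then show ?thesis by (intro commI) metis
      next
        case 2
        show ?thesis
          by (intro commI c_d_commute[of j i]) (use 2 x y in auto)
      next
        case 3
        then show ?thesis by (intro commI) metis
      next
        case 4
        then show ?thesis using a_b_commute[OF x(1)] z by blast
      next
        case 5
        have "\<phi> y \<otimes>\<^bsub>H\<^esub> \<phi> x = h (\<sigma> 1) \<otimes>\<^bsub>H\<^esub> h (\<sigma> 1) \<otimes>\<^bsub>H\<^esub> (\<phi> x \<otimes>\<^bsub>H\<^esub> \<phi> y)"
          using a_b_commute[OF x(1)] 5 by blast
        then have "\<phi> x \<otimes>\<^bsub>H\<^esub> \<phi> y = inv\<^bsub>H\<^esub> (h (\<sigma> 1) \<otimes>\<^bsub>H\<^esub> h (\<sigma> 1)) \<otimes>\<^bsub>H\<^esub> (\<phi> y \<otimes>\<^bsub>H\<^esub> \<phi> x)"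
          using closed s_closed by (simp add: H.inv_solve_left del: comp_apply)
        then show ?thesis using Z.m_inv_closed[OF z] by blast
      qed
    qed
  qed
qed

lemma lower_central_series_image_trivial: "lower_central_series H 3 = {\<one>\<^bsub>H\<^esub>}"
proof (rule H.lower_central_series_3_trivial)
  show "x \<otimes>\<^bsub>H\<^esub> y \<otimes>\<^bsub>H\<^esub> inv\<^bsub>H\<^esub> x \<otimes>\<^bsub>H\<^esub> inv\<^bsub>H\<^esub> y \<in> centraliser H (carrier H)"
    if "x \<in> carrier H" "y \<in> carrier H" for x y
    by (rule H.commutator_central[OF _ generate_\<phi> _ that])
      (use \<phi>_closed gens_commute_modulo_centre in auto)
qed

end

section \<open>Homomorphisms from surface braid groups to symmetric groups\<close>

lemma braid_relations_all_eq:
  assumes "n > m" "m \<ge> 2" "(n, m) \<noteq> (4, 3)" and act: "braid_action n s {1..m}"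
    and i: "i \<in> {1..<n}" and x: "x \<in> {1..m}"
  shows "s i x = s 1 x"
proof (cases "5 \<le> n")
  case True
  show ?thesis by (rule braid_action_eq[OF True _ _ act]) (use assms in auto)
next
  case False
  \<comment> \<open>For \<open>n < 5\<close> the exclusion of \<open>(4, 3)\<close> leaves only
    \<open>m = 2\<close>, where all permutations commute.\<close>
  then have m2: "card {1..m} \<le> 2" using assms(1-3) by auto
  have bij: "bij_betw (s 1) {1..m} {1..m}" "bij_betw (s (Suc 1)) {1..m} {1..m}"
    by (rule braid_action_bij[OF act]; use assms(1,2) in simp)+
  have e: "s 1 y = s (Suc 1) y" if y: "y \<in> {1..m}" for y
  proof (rule commuting_braid_eq[OF bij _ _ y])
    show "s 1 (s (Suc 1) z) = s (Suc 1) (s 1 z)" if "z \<in> {1..m}" for z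
      by (rule bij_betw_card_le_2(1)[OF _ m2 bij that]) simp
    show "s 1 (s (Suc 1) (s 1 z)) = s (Suc 1) (s 1 (s (Suc 1) z))" if "z \<in> {1..m}" for z
      by (rule braid_action_near[OF act]) (use assms(1,2) that in auto)
  qed
  show ?thesis
    by (rule braid_action_all_eq[OF act, of 1, OF _ _ e]) (use assms in auto)
qed

theorem proposition5p4:
  fixes g n m :: nat
    and S :: "'a topology"
    and Q :: "(nat \<Rightarrow> 'a) set"
    and a b \<sigma> :: "nat \<Rightarrow> (real \<Rightarrow> (nat \<Rightarrow> 'a) set) set"
    and \<rho> :: "(real \<Rightarrow> (nat \<Rightarrow> 'a) set) set \<Rightarrow> (nat \<Rightarrow> nat)"
  defines "B \<equiv> surface_braid_group n S Q"
    and "Bn \<equiv> generate (surface_braid_group n S Q) (\<sigma> ` {1..<n})"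
  assumes "g \<ge> 1" and "n > m" and "m \<ge> 2" and "(n, m) \<noteq> (4, 3)"
    and surface: "genus_surface g S"
    and basepoint: "Q \<in> topspace (unordered_configuration_space n S)"
    and presentation: "has_presentation B (surface_braid_generators g n) (surface_braid_relations g n)
          (case_braid_generator a b \<sigma>)"
    and hom: "\<rho> \<in> hom B (sym_group m)"
  shows
    \<comment> \<open>(a)\<close>
    "cyclic_group ((sym_group m)\<lparr>carrier := \<rho> ` Bn\<rparr>) \<and>
     (\<forall>i\<in>{1..<n}. \<rho> (\<sigma> i) = \<rho> (\<sigma> 1)) \<and>
     \<comment> \<open>(b)\<close>
     \<rho> ` carrier B \<subseteq> centraliser (sym_group m) (\<rho> ` Bn) \<and>
     (sym_group m)\<lparr>carrier := centraliser (sym_group m) (\<rho> ` Bn)\<rparr> \<cong>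
       product_group {k \<in> {1..m}. cycle_count m (\<rho> (\<sigma> 1)) k > 0}
         (\<lambda>k. wreath_product (integer_mod_group k) (cycle_count m (\<rho> (\<sigma> 1)) k)) \<and>
     \<comment> \<open>(c)\<close>
     lower_central_series B 3 \<subseteq> kernel B (sym_group m) \<rho> \<and>
     (\<exists>\<rho>' \<in> hom (B Mod lower_central_series B 3) (sym_group m).
        \<forall>x\<in>carrier B. \<rho> x = \<rho>' (lower_central_series B 3 #>\<^bsub>B\<^esub> x)) \<and>
     lower_central_series ((sym_group m)\<lparr>carrier := \<rho> ` carrier B\<rparr>) 3 = {\<one>\<^bsub>sym_group m\<^esub>}"
proof -
  let ?T = "sym_group m"
  let ?f = "case_braid_generator a b \<sigma>"
  let ?X = "surface_braid_generators g n"
  have "group B"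
    using group_surface_braid_group[OF basepoint] by (simp add: B_def)
  then interpret group_hom B ?T \<rho>
    by (intro group_hom.intro group_hom_axioms.intro sym_group_is_group hom)
  have "?f ` ?X \<subseteq> carrier B"
    using presentation unfolding has_presentation_def by (rule conjunct1)
  then have f: "?f x \<in> carrier B" if "x \<in> ?X" for x
    using that by (rule subsetD[OF _ imageI])
  have \<sigma>: "\<sigma> i \<in> carrier B" if "i \<in> {1..<n}" for i
    using f[of "Gen_s i"] that by (simp add: surface_braid_generators_def)
  have perm: "\<rho> (\<sigma> i) permutes {1..m}" if "i \<in> {1..<n}" for i
    using hom_closed[OF \<sigma>[OF that]] by (simp add: sym_group_def)
  have gen_s: "Gen_s i \<in> ?X" if "i \<in> {1..<n}" for i
    using that by (simp add: surface_braid_generators_def)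
  have "braid_action n (\<lambda>i. \<rho> (\<sigma> i)) {1..m}"
  proof (rule braid_actionI)
    show "bij_betw (\<rho> (\<sigma> i)) {1..m} {1..m}" if "1 \<le> i" "i < n" for i
      by (rule permutes_imp_bij[OF perm]) (use that in simp)
    show "\<rho> (\<sigma> i) (\<rho> (\<sigma> j) x) = \<rho> (\<sigma> j) (\<rho> (\<sigma> i) x)" if "1 \<le> i" "i + 2 \<le> j" "j < n" for i j x
    proof -
      have "word_value ?T (\<rho> \<circ> ?f) [pos (Gen_s i), pos (Gen_s j)] =
          word_value ?T (\<rho> \<circ> ?f) [pos (Gen_s j), pos (Gen_s i)]"
        by (rule hom_relation[OF presentation surface_braid_relations.s_s_far])
          (use that gen_s in \<open>auto simp: pos_def\<close>)
      then show ?thesis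
        by (simp add: pos_def sym_group_def fun_eq_iff)
    qed
    show "\<rho> (\<sigma> i) (\<rho> (\<sigma> (Suc i)) (\<rho> (\<sigma> i) x)) = \<rho> (\<sigma> (Suc i)) (\<rho> (\<sigma> i) (\<rho> (\<sigma> (Suc i)) x))"
      if "1 \<le> i" "i + 2 \<le> n" for i x
    proof -
      have "word_value ?T (\<rho> \<circ> ?f) [pos (Gen_s i), pos (Gen_s (i + 1)), pos (Gen_s i)] =
          word_value ?T (\<rho> \<circ> ?f) [pos (Gen_s (i + 1)), pos (Gen_s i), pos (Gen_s (i + 1))]"
        by (rule hom_relation[OF presentation surface_braid_relations.s_s_near])
          (use that gen_s in \<open>auto simp: pos_def\<close>)
      then show ?thesis
        by (simp add: pos_def sym_group_def fun_eq_iff)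
    qed
  qed
  note act = this
  have one: "1 \<in> {1..<n}" using \<open>n > m\<close> \<open>m \<ge> 2\<close> by simp
  \<comment> \<open>The equality is one of functions on all naturals; outside \<open>{1..m}\<close>
    both are the identity.\<close>
  have all_eq: "\<rho> (\<sigma> i) = \<rho> (\<sigma> 1)" if i: "i \<in> {1..<n}" for i
  proof
    fix x
    show "\<rho> (\<sigma> i) x = \<rho> (\<sigma> 1) x"
    proof (cases "x \<in> {1..m}")
      case True
      show ?thesis
        by (rule braid_relations_all_eq[OF \<open>n > m\<close> \<open>m \<ge> 2\<close> \<open>(n, m) \<noteq> (4, 3)\<close> act i True])
    next
      case False
      then show ?thesis
        using permutes_not_in[OF perm[OF i] False] permutes_not_in[OF perm[OF one] False] by simp
    qed
  qed
  define s where "s = \<rho> (\<sigma> 1)"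
  have sT: "s \<in> carrier ?T" using hom_closed[OF \<sigma>[OF one]] by (simp add: s_def)
  have "(\<lambda>i. \<rho> (\<sigma> i)) ` {1..<n} = (\<lambda>i. s) ` {1..<n}"
    unfolding s_def by (rule image_cong[OF HOL.refl all_eq])
  then have "\<rho> ` \<sigma> ` {1..<n} = {s}"
    using one by (auto simp: image_image)
  then have im: "\<rho> ` Bn = generate ?T {s}"
    using generate_img[of "\<sigma> ` {1..<n}"] \<sigma> by (simp add: Bn_def B_def image_subset_iff)
  have centraliser: "centraliser ?T (\<rho> ` Bn) = centraliser ?T {s}"
    unfolding im using H.centraliser_generate[of "{s}"] sT by simp
  \<comment> \<open>With the image of \<open>\<rho>\<close> as carrier, the centre and the lower
    central series of \<open>I\<close> are those of the image.\<close>
  define I where "I = ?T\<lparr>carrier := \<rho> ` carrier B\<rparr>"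
  have subgroup: "subgroup (\<rho> ` carrier B) ?T" by (rule img_is_subgroup)
  have "group I"
    unfolding I_def by (rule H.subgroup_imp_group[OF subgroup])
  moreover have "\<rho> \<in> hom B I"
    using hom by (auto simp: hom_def I_def)
  ultimately have "group_hom B I \<rho>"
    by (intro group_hom.intro group_hom_axioms.intro \<open>group B\<close>)
  moreover have "surface_braid_hom_axioms B I \<rho> g n a b \<sigma>"
  proof
    show "3 \<le> n" using \<open>n > m\<close> \<open>m \<ge> 2\<close> by simp
    show "\<rho> ` carrier B = carrier I" by (simp add: I_def)
  qed (fact presentation all_eq)+
  ultimately interpret I: surface_braid_hom B I \<rho> g n a b \<sigma>
    by (rule surface_braid_hom.intro)
  have "cyclic_group (subgroup_generated ?T {s})"
    by (rule H.cyclic_group_generated)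
  then have cyclic: "cyclic_group (?T\<lparr>carrier := \<rho> ` Bn\<rparr>)"
    using sT by (simp add: subgroup_generated_def im)
  have cent: "\<rho> ` carrier B \<subseteq> centraliser ?T (\<rho> ` Bn)"
  proof
    fix y assume y: "y \<in> \<rho> ` carrier B"
    then have "s \<otimes>\<^bsub>I\<^esub> y = y \<otimes>\<^bsub>I\<^esub> s"
      unfolding s_def by (intro centraliserD[OF I.s_central]) (simp add: I_def)
    then show "y \<in> centraliser ?T (\<rho> ` Bn)"
      unfolding centraliser using y by (intro centraliserI) (auto simp: I_def)
  qed
  obtain r where "cycle_coordinates m s {k \<in> {1..m}. 0 < cycle_count m s k} (cycle_count m s) r"
    using cycle_coordinates_exist perm[OF one] unfolding s_def by blast
  then have iso: "?T\<lparr>carrier := centraliser ?T (\<rho> ` Bn)\<rparr> \<cong>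
      product_group {k \<in> {1..m}. cycle_count m s k > 0}
         (\<lambda>k. wreath_product (integer_mod_group k) (cycle_count m s k))"
    unfolding centraliser by (rule cycle_coordinates.centraliser_iso_wreaths)
  have trivial: "lower_central_series I 3 = {\<one>\<^bsub>?T\<^esub>}"
    using I.lower_central_series_image_trivial by (simp add: I_def)
  \<comment> \<open>Regarded as a homomorphism to \<open>I\<close>, \<open>\<rho>\<close> maps the
    third term of the series of \<open>B\<close> into that of \<open>I\<close>, which is
    trivial.\<close>
  have ker: "lower_central_series B 3 \<subseteq> kernel B ?T \<rho>"
    using I.lower_central_series_image[of 3] G.lower_central_series_subset[of 3] trivial
    by (auto simp: kernel_def)
  have "\<one>\<^bsub>B\<^esub> \<in> lower_central_series B 3"
    unfolding numeral_3_eq_3 lower_central_series.simps by (rule generate.one)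
  note factor = hom_factors_through_cosets[OF ker this]
  show ?thesis
    by (intro conjI cyclic ballI[OF all_eq] cent iso[unfolded s_def] ker factor trivial[unfolded I_def])
qed

end
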